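(* Let $f\in H_{1/2}$. Then there exists an absolute constant $c$ such that $$\frac1{\log n}\sum_{k=1}^{n}\frac{\|\sigma_kf\|_{1/2}^{1/2}}{k}\le c\,\|f\|_{H_{1/2}}^{1/2}\qquad (n=2,3,\dots).$$
   Context: $\mathbb N_+$ is the set of positive integers, $\mathbb N=\mathbb N_+\cup\{0\}$. Fix a bounded sequence $m=(m_0,m_1,\dots)$ of integers $m_k\ge 2$. $G_m=\prod_{k\ge0}Z_{m_k}$, where $Z_{m_k}=\{0,\dots,m_k-1\}$ is the additive group modulo $m_k$, with the product of the discrete topologies; $\mu$ is the Haar measure with $\mu(G_m)=1$. $M_0:=1$, $M_{k+1}:=m_kM_k$; every $n\in\mathbb N$ is uniquely $n=\sum_{j\ge0}n_jM_j$ with $n_j\in Z_{m_j}$. $r_k(x):=\exp(2\pi i x_k/m_k)$, $\psi_n:=\prod_{k\ge0}r_k^{n_k}$ (Vilenkin system). $I_0(x):=G_m$, $I_n(x):=\{y: y_0=x_0,\dots,y_{n-1}=x_{n-1}\}$; $\mathcal F_n$ is the $\sigma$-algebra generated by $\{I_n(x):x\in G_m\}$. For $g\in L_1(G_m)$: $\widehat g(k):=\int g\overline{\psi_k}\,d\mu$, $S_ng:=\sum_{k=0}^{n-1}\widehat g(k)\psi_k$. A martingale is a sequence $f=(f^{(n)}:n\in\mathbb N)$ of integrable functions with $f^{(n)}$ $\mathcal F_n$-measurable and $S_{M_n}f^{(k)}=f^{(n)}$ for $n\le k$; $f^*:=\sup_n|f^{(n)}|$; $H_p$ is the set of martingales with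 $\|f\|_{H_p}:=\|f^*\|_p<\infty$, where $\|g\|_p:=(\int|g|^pd\mu)^{1/p}$. For a martingale, $\widehat f(i):=\lim_k\int f^{(k)}\overline{\psi_i}\,d\mu$, $S_nf:=\sum_{k=0}^{n-1}\widehat f(k)\psi_k$, and $\sigma_nf:=\frac1n\sum_{k=1}^nS_kf$ ($n\in\mathbb N_+$). The sequence $m$ is fixed; the absolute constant $c$ does not depend on $f$ or $n$ (it may depend on $m$). *)

theory Defs
  imports "HOL-Probability.Probability"
begin

section \<open>The Vilenkin group\<close>

definition vgroup :: "(nat \<Rightarrow> nat) \<Rightarrow> (nat \<Rightarrow> nat) set" where
  "vgroup m = (\<Pi>\<^sub>E k\<in>UNIV. {..<m k})"

definition vadd :: "(nat \<Rightarrow> nat) \<Rightarrow> (nat \<Rightarrow> nat) \<Rightarrow> (nat \<Rightarrow> nat) \<Rightarrow> (nat \<Rightarrow> nat)" where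
  "vadd m a x = (\<lambda>k. (a k + x k) mod m k)"

definition vtopology :: "(nat \<Rightarrow> nat) \<Rightarrow> (nat \<Rightarrow> nat) topology" where
  "vtopology m = product_topology (\<lambda>k. discrete_topology {..<m k}) UNIV"

text \<open>Haar measure on the Borel sets of the group, normalised to total mass 1.
  The group is compact, metrizable and abelian, so neither regularity nor the side on which
  one translates needs to be mentioned. Existence and uniqueness are established below.\<close>

definition haar_prob :: "(nat \<Rightarrow> nat) \<Rightarrow> (nat \<Rightarrow> nat) measure \<Rightarrow> bool" where
  "haar_prob m \<mu> \<longleftrightarrow>
     space \<mu> = vgroup m \<and>
     sets \<mu> = sigma_sets (vgroup m) {U. openin (vtopology m) U} \<and>
     (\<forall>a\<in>vgroup m. \<forall>A\<in>sets \<mu>. emeasure \<mu> (vadd m a ` A) = emeasure \<mu> A) \<and>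
     emeasure \<mu> (vgroup m) = 1"

definition vcyl :: "(nat \<Rightarrow> nat) \<Rightarrow> nat \<Rightarrow> (nat \<Rightarrow> nat) \<Rightarrow> (nat \<Rightarrow> nat) set" where
  "vcyl m n x = {y \<in> vgroup m. \<forall>i<n. y i = x i}"

definition vfilt :: "(nat \<Rightarrow> nat) \<Rightarrow> nat \<Rightarrow> (nat \<Rightarrow> nat) measure" where
  "vfilt m n = sigma (vgroup m) {vcyl m n x | x. x \<in> vgroup m}"


section \<open>The Vilenkin system\<close>

definition vM :: "(nat \<Rightarrow> nat) \<Rightarrow> nat \<Rightarrow> nat" where
  "vM m k = (\<Prod>j<k. m j)"

text \<open>The coefficients of \<open>n = (\<Sum>j. n\<^sub>j * M\<^sub>j)\<close>, see \<open>vdigit_unique\<close> below.\<close>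

definition vdigit :: "(nat \<Rightarrow> nat) \<Rightarrow> nat \<Rightarrow> nat \<Rightarrow> nat" where
  "vdigit m n j = (n div vM m j) mod m j"

definition vrad :: "(nat \<Rightarrow> nat) \<Rightarrow> nat \<Rightarrow> (nat \<Rightarrow> nat) \<Rightarrow> complex" where
  "vrad m k x = exp (2 * of_real pi * \<i> * of_nat (x k) / of_nat (m k))"

definition vpsi :: "(nat \<Rightarrow> nat) \<Rightarrow> nat \<Rightarrow> (nat \<Rightarrow> nat) \<Rightarrow> complex" where
  "vpsi m n x = (\<Prod>k | vdigit m n k \<noteq> 0. vrad m k x ^ vdigit m n k)"


section \<open>Fourier coefficients, martingales and Fejer means\<close>

definition fun_coeff ::
  "(nat \<Rightarrow> nat) \<Rightarrow> (nat \<Rightarrow> nat) measure \<Rightarrow> ((nat \<Rightarrow> nat) \<Rightarrow> complex) \<Rightarrow> nat \<Rightarrow> complex" where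
  "fun_coeff m \<mu> g k = (\<integral>x. g x * cnj (vpsi m k x) \<partial>\<mu>)"

definition fun_partial_sum ::
  "(nat \<Rightarrow> nat) \<Rightarrow> (nat \<Rightarrow> nat) measure \<Rightarrow> ((nat \<Rightarrow> nat) \<Rightarrow> complex) \<Rightarrow> nat \<Rightarrow> (nat \<Rightarrow> nat) \<Rightarrow> complex"
  where
  "fun_partial_sum m \<mu> g n x = (\<Sum>k<n. fun_coeff m \<mu> g k * vpsi m k x)"

text \<open>Both sides of the martingale identity are constant on the cylinders of a fixed level, which
  have positive measure; hence equality almost everywhere is equality on the whole group.\<close>

definition vmartingale ::
  "(nat \<Rightarrow> nat) \<Rightarrow> (nat \<Rightarrow> nat) measure \<Rightarrow> (nat \<Rightarrow> (nat \<Rightarrow> nat) \<Rightarrow> complex) \<Rightarrow> bool" where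
  "vmartingale m \<mu> f \<longleftrightarrow>
     (\<forall>n. integrable \<mu> (f n)) \<and>
     (\<forall>n. f n \<in> borel_measurable (vfilt m n)) \<and>
     (\<forall>k n. n \<le> k \<longrightarrow> (\<forall>x\<in>vgroup m. fun_partial_sum m \<mu> (f k) (vM m n) x = f n x))"

definition mart_coeff ::
  "(nat \<Rightarrow> nat) \<Rightarrow> (nat \<Rightarrow> nat) measure \<Rightarrow> (nat \<Rightarrow> (nat \<Rightarrow> nat) \<Rightarrow> complex) \<Rightarrow> nat \<Rightarrow> complex" where
  "mart_coeff m \<mu> f i = lim (\<lambda>k. fun_coeff m \<mu> (f k) i)"

definition mart_partial_sum ::
  "(nat \<Rightarrow> nat) \<Rightarrow> (nat \<Rightarrow> nat) measure \<Rightarrow> (nat \<Rightarrow> (nat \<Rightarrow> nat) \<Rightarrow> complex) \<Rightarrow>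
     nat \<Rightarrow> (nat \<Rightarrow> nat) \<Rightarrow> complex" where
  "mart_partial_sum m \<mu> f n x = (\<Sum>k<n. mart_coeff m \<mu> f k * vpsi m k x)"

definition fejer_mean ::
  "(nat \<Rightarrow> nat) \<Rightarrow> (nat \<Rightarrow> nat) measure \<Rightarrow> (nat \<Rightarrow> (nat \<Rightarrow> nat) \<Rightarrow> complex) \<Rightarrow>
     nat \<Rightarrow> (nat \<Rightarrow> nat) \<Rightarrow> complex" where
  "fejer_mean m \<mu> f n x = (\<Sum>k=1..n. mart_partial_sum m \<mu> f k x) / of_nat n"


section \<open>Quasi-norms\<close>

text \<open>Power with exponent \<open>p > 0\<close> on \<open>[0,\<infinity>]\<close>.\<close>

definition epowr :: "ennreal \<Rightarrow> real \<Rightarrow> ennreal" where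
  "epowr a p = (if a = \<top> then \<top> else ennreal (enn2real a powr p))"

definition Lp_norm :: "'a measure \<Rightarrow> real \<Rightarrow> ('a \<Rightarrow> ennreal) \<Rightarrow> ennreal" where
  "Lp_norm \<mu> p g = epowr (\<integral>\<^sup>+ x. epowr (g x) p \<partial>\<mu>) (1 / p)"

definition mart_max :: "(nat \<Rightarrow> (nat \<Rightarrow> nat) \<Rightarrow> complex) \<Rightarrow> (nat \<Rightarrow> nat) \<Rightarrow> ennreal" where
  "mart_max f x = (SUP n. ennreal (cmod (f n x)))"

definition hardy_norm ::
  "(nat \<Rightarrow> nat) measure \<Rightarrow> real \<Rightarrow> (nat \<Rightarrow> (nat \<Rightarrow> nat) \<Rightarrow> complex) \<Rightarrow> ennreal" where
  "hardy_norm \<mu> p f = Lp_norm \<mu> p (mart_max f)"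

definition hardy_space ::
  "(nat \<Rightarrow> nat) \<Rightarrow> (nat \<Rightarrow> nat) measure \<Rightarrow> real \<Rightarrow> (nat \<Rightarrow> (nat \<Rightarrow> nat) \<Rightarrow> complex) set" where
  "hardy_space m \<mu> p = {f. vmartingale m \<mu> f \<and> hardy_norm \<mu> p f < \<infinity>}"


section \<open>Well-definedness of the digits\<close>

lemma m_pos: "\<forall>k. 2 \<le> m k \<Longrightarrow> 0 < (m k :: nat)"
  by (metis gr_zeroI not_numeral_le_zero)

lemma vM_0: "vM m 0 = 1" and vM_Suc: "vM m (Suc k) = m k * vM m k"
  by (simp_all add: vM_def mult.commute)

lemma vM_ge:
  assumes "\<forall>k. 2 \<le> m k"
  shows "k < vM m k"
proof (induction k)
  case (Suc k)
  have "2 * vM m k \<le> m k * vM m k"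
    using assms by simp
  with Suc show ?case unfolding vM_Suc by linarith
qed (simp add: vM_0)

lemma vM_mod_Suc: "n mod vM m (Suc K) = n mod vM m K + vM m K * vdigit m n K"
  using mod_mult2_eq[of n "vM m K" "m K"] by (simp add: vM_Suc vdigit_def mult.commute)

lemma vdigit_sum: "(\<Sum>j<K. vdigit m n j * vM m j) = n mod vM m K"
  by (induction K) (simp_all add: vM_0 vM_mod_Suc mult.commute)

lemma sum_vM_less:
  assumes "\<forall>j. d j < m j"
  shows "(\<Sum>j<K. d j * vM m j) < vM m K"
proof (induction K)
  case (Suc K)
  have "Suc (d K) * vM m K \<le> m K * vM m K"
    using assms by (intro mult_right_mono) (auto simp: Suc_le_eq)
  with Suc show ?case by (simp add: vM_Suc)
qed (simp add: vM_0)

lemma vdigit_of_sum: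
  assumes "\<forall>j. d j < m j" "j < K"
  shows "vdigit m (\<Sum>i<K. d i * vM m i) j = d j"
  using assms(2)
proof (induction K)
  case (Suc K)
  let ?s = "\<Sum>i<K. d i * vM m i"
  have pos: "0 < vM m i" for i
    using assms(1) by (auto simp: vM_def intro!: prod_pos) (metis gr_zeroI not_less0)
  show ?case
  proof (cases "j = K")
    case True
    have "(?s + d K * vM m K) div vM m K = d K"
      using sum_vM_less[OF assms(1), of K] pos[of K] by simp
    then show ?thesis using True assms(1) by (simp add: vdigit_def)
  next
    case False
    then have "j < K" using Suc by simp
    have "\<exists>q. vM m K = vM m (Suc j) * q"
      using \<open>j < K\<close> unfolding vM_def
      by (metis Suc_leI dvd_def finite_lessThan lessThan_subset_iff prod_dvd_prod_subset)
    then obtain q where q: "vM m K = vM m j * (m j * q)"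
      by (auto simp: vM_Suc mult_ac)
    have "(?s + d K * vM m K) div vM m j = ?s div vM m j + m j * (q * d K)"
      using pos[of j] div_mult_self2[of "vM m j" ?s "m j * (q * d K)"] by (simp add: q mult_ac)
    then show ?thesis
      using Suc.IH[OF \<open>j < K\<close>] by (simp add: vdigit_def)
  qed
qed simp

lemma vdigit_unique:
  assumes m: "\<forall>k. 2 \<le> m k"
  shows "(\<forall>j. d j < m j) \<and> finite {j. d j \<noteq> 0} \<and> n = (\<Sum>j | d j \<noteq> 0. d j * vM m j)
           \<longleftrightarrow> d = vdigit m n" (is "?L \<longleftrightarrow> ?R")
proof
  assume L: ?L
  then obtain K where K: "{j. d j \<noteq> 0} \<subseteq> {..<K}"
    by (meson finite_nat_iff_bounded)
  show ?R
  proof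
    fix j
    have "n = (\<Sum>i<max K (Suc j). d i * vM m i)"
      using L K by (auto intro!: sum.mono_neutral_left)
    then show "d j = vdigit m n j"
      using vdigit_of_sum[of d m j "max K (Suc j)"] L by simp
  qed
next
  assume R: ?R
  have lt: "vdigit m n j < m j" for j
  proof -
    have "2 \<le> m j" using m by blast
    then show ?thesis by (simp add: vdigit_def)
  qed
  have z: "vdigit m n j = 0" if "n \<le> j" for j
    using vM_ge[OF m, of j] that by (simp add: vdigit_def)
  have sub: "{j. vdigit m n j \<noteq> 0} \<subseteq> {..<n}"
    using z by (metis (mono_tags, lifting) lessThan_iff mem_Collect_eq not_le subsetI)
  have "n = (\<Sum>j<n. vdigit m n j * vM m j)"
    using vM_ge[OF m, of n] by (simp add: vdigit_sum)
  also have "\<dots> = (\<Sum>j | vdigit m n j \<noteq> 0. vdigit m n j * vM m j)"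
    using sub by (intro sum.mono_neutral_right) auto
  finally show ?L using R lt finite_subset[OF sub] by simp
qed


section \<open>Existence and uniqueness of the Haar measure\<close>

definition vgen :: "(nat \<Rightarrow> nat) \<Rightarrow> (nat \<Rightarrow> nat) set set" where
  "vgen m = insert {} {vcyl m n x | n x. x \<in> vgroup m}"

lemma vgroup_iff: "x \<in> vgroup m \<longleftrightarrow> (\<forall>k. x k < m k)"
  by (auto simp: vgroup_def)

lemma vcyl_subset: "vcyl m n x \<subseteq> vgroup m"
  by (auto simp: vcyl_def)

lemma topspace_vtopology: "topspace (vtopology m) = vgroup m"
  by (simp add: vtopology_def vgroup_def)

lemma vcyl_PiE:
  assumes "x \<in> vgroup m"
  shows "vcyl m n x = (\<Pi>\<^sub>E k\<in>UNIV. if k < n then {x k} else {..<m k})" (is "_ = ?P")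
proof (rule set_eqI)
  fix y
  show "y \<in> vcyl m n x \<longleftrightarrow> y \<in> ?P"
    using assms by (auto simp: vcyl_def vgroup_iff PiE_iff split: if_splits)
qed

lemma openin_vcyl:
  assumes "x \<in> vgroup m"
  shows "openin (vtopology m) (vcyl m n x)"
proof -
  have "finite {i. (if i < n then {x i} else {..<m i}) \<noteq> {..<m i}}"
    by (rule finite_subset[of _ "{..<n}"]) (auto split: if_splits)
  then show ?thesis
    using assms unfolding vcyl_PiE[OF assms] vtopology_def
    by (auto simp: openin_PiE_gen vgroup_iff)
qed

lemma openin_vtopology_vcyl:
  assumes "openin (vtopology m) U" "x \<in> U"
  shows "\<exists>n. vcyl m n x \<subseteq> U"
proof -
  obtain V where V: "finite {i. V i \<noteq> {..<m i}}" "x \<in> PiE UNIV V" "PiE UNIV V \<subseteq> U"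
    using assms unfolding vtopology_def openin_product_topology_alt by force
  then obtain n where n: "{i. V i \<noteq> {..<m i}} \<subseteq> {..<n}"
    by (meson finite_nat_iff_bounded)
  have "vcyl m n x \<subseteq> PiE UNIV V"
  proof
    fix y assume y: "y \<in> vcyl m n x"
    have "y i \<in> V i" for i
    proof (cases "i < n")
      case True then show ?thesis using y V(2) by (auto simp: vcyl_def PiE_iff)
    next
      case False
      then have "V i = {..<m i}" using n by auto
      then show ?thesis using y by (auto simp: vcyl_def vgroup_iff)
    qed
    then show "y \<in> PiE UNIV V" by auto
  qed
  with V(3) show ?thesis by blast
qed

definition vrep :: "(nat \<Rightarrow> nat) \<Rightarrow> nat \<Rightarrow> (nat \<Rightarrow> nat) set" where
  "vrep m n = (\<lambda>r k. if k < n then r k else 0) ` (\<Pi>\<^sub>E k\<in>{..<n}. {..<m k})"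

lemma finite_vrep: "finite (vrep m n)"
  unfolding vrep_def by (intro finite_imageI finite_PiE) auto

lemma card_vrep: "card (vrep m n) = vM m n"
proof -
  have "inj_on (\<lambda>r k. if k < n then r k else 0) (\<Pi>\<^sub>E k\<in>{..<n}. {..<m k})"
    by (rule inj_onI, rule PiE_ext) (auto simp: fun_eq_iff, metis)
  then show ?thesis
    by (simp add: vrep_def card_image card_PiE vM_def)
qed

lemma vrep_subset:
  assumes "\<forall>k. 2 \<le> m k"
  shows "vrep m n \<subseteq> vgroup m"
  using m_pos[OF assms] by (auto simp: vrep_def vgroup_iff PiE_iff)

lemma vrep_disjoint: "disjoint_family_on (vcyl m n) (vrep m n)"
  by (auto simp: disjoint_family_on_def vrep_def vcyl_def fun_eq_iff split: if_splits)

lemma vrep_ex: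
  assumes "x \<in> vgroup m"
  shows "\<exists>r\<in>vrep m n. vcyl m n r = vcyl m n x"
proof
  show "(\<lambda>k. if k < n then x k else 0) \<in> vrep m n"
    unfolding vrep_def using assms
    by (intro image_eqI[of _ _ "restrict x {..<n}"]) (auto simp: vgroup_iff)
qed (auto simp: vcyl_def)

lemma vrep_Union: "(\<Union>r\<in>vrep m n. vcyl m n r) = vgroup m"
proof
  show "vgroup m \<subseteq> (\<Union>r\<in>vrep m n. vcyl m n r)"
  proof
    fix x assume x: "x \<in> vgroup m"
    then have "x \<in> vcyl m n x" by (simp add: vcyl_def)
    with vrep_ex[OF x, of n] show "x \<in> (\<Union>r\<in>vrep m n. vcyl m n r)" by blast
  qed
qed (auto simp: vcyl_def)

lemma countable_vgen: "countable (vgen m)"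
proof -
  have "vgen m \<subseteq> insert {} (\<Union>n. vcyl m n ` vrep m n)"
  proof
    fix A assume "A \<in> vgen m"
    then consider "A = {}" | n x where "A = vcyl m n x" "x \<in> vgroup m"
      unfolding vgen_def by blast
    then show "A \<in> insert {} (\<Union>n. vcyl m n ` vrep m n)"
    proof cases
      case 2
      with vrep_ex[of x m n] show ?thesis by blast
    qed simp
  qed
  moreover have "countable (insert {} (\<Union>n. vcyl m n ` vrep m n))"
    by (simp add: countable_finite finite_vrep)
  ultimately show ?thesis by (rule countable_subset)
qed

lemma vgen_Pow: "vgen m \<subseteq> Pow (vgroup m)"
  by (auto simp: vgen_def vcyl_def)

lemma Int_stable_vgen: "Int_stable (vgen m)"
proof (rule Int_stableI)
  fix A B assume AB: "A \<in> vgen m" "B \<in> vgen m"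
  show "A \<inter> B \<in> vgen m"
  proof (cases "A \<inter> B = {}")
    case False
    then obtain z where z: "z \<in> A" "z \<in> B" by blast
    then obtain a x b y where "A = vcyl m a x" "B = vcyl m b y"
      using AB by (auto simp: vgen_def)
    with z have "A \<inter> B = vcyl m (max a b) z" "z \<in> vgroup m"
      by (auto simp: vcyl_def less_max_iff_disj)
    then show ?thesis by (auto simp: vgen_def)
  qed (simp add: vgen_def)
qed

lemma sigma_sets_vtopology:
  "sigma_sets (vgroup m) {U. openin (vtopology m) U} = sigma_sets (vgroup m) (vgen m)"
proof (rule sigma_sets_eqI)
  fix U assume "U \<in> {U. openin (vtopology m) U}"
  then have U: "openin (vtopology m) U" by simp
  let ?C = "{A \<in> vgen m. A \<subseteq> U}"
  have "U \<subseteq> \<Union>?C"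
  proof
    fix x assume x: "x \<in> U"
    then have xg: "x \<in> vgroup m" using openin_subset[OF U] by (auto simp: topspace_vtopology)
    obtain n where "vcyl m n x \<subseteq> U" using openin_vtopology_vcyl[OF U x] by blast
    moreover have "x \<in> vcyl m n x" using xg by (simp add: vcyl_def)
    ultimately show "x \<in> \<Union>?C" using xg by (auto simp: vgen_def)
  qed
  then have "U = \<Union>?C" by blast
  moreover have "\<Union>?C \<in> sigma_sets (vgroup m) (vgen m)"
    by (rule sigma_sets_UNION)
      (auto intro: countable_subset[OF _ countable_vgen[of m]])
  ultimately show "U \<in> sigma_sets (vgroup m) (vgen m)" by simp
next
  fix A assume "A \<in> vgen m"
  then have "openin (vtopology m) A" using openin_vcyl by (auto simp: vgen_def)
  then show "A \<in> sigma_sets (vgroup m) {U. openin (vtopology m) U}"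
    by (intro sigma_sets.Basic) simp
qed

lemma vgen_measure_eqI:
  assumes "sets M = sigma_sets (vgroup m) (vgen m)" "sets N = sigma_sets (vgroup m) (vgen m)"
    and "\<forall>k. 2 \<le> m k"
    and "\<And>n x. x \<in> vgroup m \<Longrightarrow> emeasure M (vcyl m n x) = ennreal (1 / vM m n)"
    and "\<And>n x. x \<in> vgroup m \<Longrightarrow> emeasure N (vcyl m n x) = ennreal (1 / vM m n)"
  shows "M = N"
proof (rule measure_eqI_generator_eq[OF Int_stable_vgen vgen_Pow _ assms(1,2)])
  have 0: "(\<lambda>_. 0) \<in> vgroup m"
    using m_pos[OF assms(3)] by (simp add: vgroup_iff)
  have G: "vgroup m = vcyl m 0 (\<lambda>_. 0)" by (auto simp: vcyl_def)
  show "range (\<lambda>_::nat. vgroup m) \<subseteq> vgen m"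
  proof -
    have "vcyl m 0 (\<lambda>_. 0) \<in> vgen m" using 0 unfolding vgen_def by blast
    then have "vgroup m \<in> vgen m" by (simp only: G[symmetric])
    then show ?thesis by blast
  qed
  show "emeasure M (vgroup m) \<noteq> \<infinity>"
    using assms(4)[OF 0, of 0] by (simp add: vM_def G[symmetric])
  show "(\<Union>i::nat. vgroup m) = vgroup m" by simp
  fix X assume "X \<in> vgen m"
  then consider "X = {}" | n x where "X = vcyl m n x" "x \<in> vgroup m"
    unfolding vgen_def by blast
  then show "emeasure M X = emeasure N X"
    by cases (simp_all add: assms(4,5))
qed

lemma vadd_closed: "\<forall>k. 2 \<le> m k \<Longrightarrow> vadd m a x \<in> vgroup m"
  using m_pos[of m] by (simp add: vgroup_iff vadd_def)

definition vneg :: "(nat \<Rightarrow> nat) \<Rightarrow> (nat \<Rightarrow> nat) \<Rightarrow> (nat \<Rightarrow> nat)" where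
  "vneg m a = (\<lambda>k. (m k - a k) mod m k)"

lemma vadd_vneg:
  assumes "a \<in> vgroup m" "x \<in> vgroup m"
  shows "vadd m a (vadd m (vneg m a) x) = x" "vadd m (vneg m a) (vadd m a x) = x"
proof -
  have less: "a k < m k" "x k < m k" for k using assms by (auto simp: vgroup_iff)
  have "a k + (m k - a k + x k) = x k + m k" "m k - a k + (a k + x k) = x k + m k" for k
    using less(1)[of k] by linarith+
  then have "(a k + (m k - a k + x k)) mod m k = x k" "(m k - a k + (a k + x k)) mod m k = x k" for k
    using less(2)[of k] by (simp_all only: mod_add_self2 mod_less)
  then show "vadd m a (vadd m (vneg m a) x) = x" "vadd m (vneg m a) (vadd m a x) = x"
    unfolding vadd_def vneg_def mod_simps by simp_all
qed

lemma vadd_image: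
  assumes "\<forall>k. 2 \<le> m k" "a \<in> vgroup m" "A \<subseteq> vgroup m"
  shows "vadd m a ` A = vadd m (vneg m a) -` A \<inter> vgroup m"
proof
  show "vadd m a ` A \<subseteq> vadd m (vneg m a) -` A \<inter> vgroup m"
    using assms vadd_closed vadd_vneg(2) by fastforce
  show "vadd m (vneg m a) -` A \<inter> vgroup m \<subseteq> vadd m a ` A"
  proof
    fix y assume "y \<in> vadd m (vneg m a) -` A \<inter> vgroup m"
    then show "y \<in> vadd m a ` A"
      using vadd_vneg(1)[OF assms(2), of y] by (intro image_eqI[of _ _ "vadd m (vneg m a) y"]) auto
  qed
qed

lemma vneg_closed: "\<forall>k. 2 \<le> m k \<Longrightarrow> vneg m a \<in> vgroup m"
  using m_pos[of m] by (simp add: vgroup_iff vneg_def)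

lemma vadd_vcyl:
  assumes m: "\<forall>k. 2 \<le> m k" and a: "a \<in> vgroup m" and x: "x \<in> vgroup m"
  shows "vadd m a ` vcyl m n x = vcyl m n (vadd m a x)"
proof (intro set_eqI)
  fix y
  have "(vadd m (vneg m a) y \<in> vcyl m n x) = (y \<in> vcyl m n (vadd m a x))" if y: "y \<in> vgroup m"
  proof -
    have "vadd m (vneg m a) y i = x i \<longleftrightarrow> y i = vadd m a x i" for i
    proof
      assume "vadd m (vneg m a) y i = x i"
      then have "vadd m a (vadd m (vneg m a) y) i = vadd m a x i" by (simp add: vadd_def)
      then show "y i = vadd m a x i" using vadd_vneg(1)[OF a y] by simp
    next
      assume "y i = vadd m a x i"
      then have "vadd m (vneg m a) y i = vadd m (vneg m a) (vadd m a x) i" by (simp add: vadd_def)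
      then show "vadd m (vneg m a) y i = x i" using vadd_vneg(2)[OF a x] by simp
    qed
    then show ?thesis using y vadd_closed[OF m] by (auto simp: vcyl_def)
  qed
  then show "y \<in> vadd m a ` vcyl m n x \<longleftrightarrow> y \<in> vcyl m n (vadd m a x)"
    unfolding vadd_image[OF m a vcyl_subset] using vcyl_subset by blast
qed

lemma haar_prob_vcyl:
  assumes m: "\<forall>k. 2 \<le> m k" and h: "haar_prob m \<mu>" and x: "x \<in> vgroup m"
  shows "emeasure \<mu> (vcyl m n x) = ennreal (1 / vM m n)"
proof -
  have sets: "vcyl m n r \<in> sets \<mu>" if "r \<in> vgroup m" for r
    using h openin_vcyl[OF that] by (auto simp: haar_prob_def)
  have eq: "emeasure \<mu> (vcyl m n r) = emeasure \<mu> (vcyl m n x)" if r: "r \<in> vrep m n" for r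
  proof -
    have rg: "r \<in> vgroup m" using r vrep_subset[OF m] by blast
    let ?a = "vadd m r (vneg m x)"
    have "vadd m ?a x = r"
      using vadd_vneg(2)[OF rg x] vadd_vneg(2)[OF x rg]
      by (auto simp: vadd_def fun_eq_iff mod_simps add_ac)
    then have "vadd m ?a ` vcyl m n x = vcyl m n r"
      using vadd_vcyl[OF m vadd_closed[OF m] x] by metis
    then show ?thesis
      using h sets[OF x] vadd_closed[OF m] unfolding haar_prob_def by metis
  qed
  have "1 = emeasure \<mu> (\<Union>r\<in>vrep m n. vcyl m n r)"
    using h by (simp add: vrep_Union haar_prob_def)
  also have "\<dots> = (\<Sum>r\<in>vrep m n. emeasure \<mu> (vcyl m n r))"
    by (rule sum_emeasure[symmetric])
      (use sets vrep_subset[OF m] finite_vrep vrep_disjoint in auto)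
  also have "\<dots> = of_nat (vM m n) * emeasure \<mu> (vcyl m n x)"
    using eq by (simp add: card_vrep)
  finally have 1: "of_nat (vM m n) * emeasure \<mu> (vcyl m n x) = 1" by simp
  have pos: "0 < vM m n" using vM_ge[OF m, of n] by simp
  have "emeasure \<mu> (vcyl m n x) = ennreal (1 / vM m n) * (of_nat (vM m n) * emeasure \<mu> (vcyl m n x))"
    using pos by (simp add: mult.assoc[symmetric] ennreal_of_nat_eq_real_of_nat ennreal_mult[symmetric])
  then show ?thesis using 1 by simp
qed

theorem haar_prob_iff:
  assumes m: "\<forall>k. 2 \<le> m k"
  shows "haar_prob m \<mu> \<longleftrightarrow> \<mu> = PiM UNIV (\<lambda>k. uniform_count_measure {..<m k})" (is "_ \<longleftrightarrow> \<mu> = ?P")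
proof -
  have ne: "{..<m k} \<noteq> {}" for k using m_pos[OF m, of k] by auto
  interpret product_prob_space "\<lambda>k. uniform_count_measure {..<m k}" UNIV
    using ne by (intro product_prob_spaceI prob_space_uniform_count_measure) auto
  have space_P: "space ?P = vgroup m"
    by (simp add: space_PiM space_uniform_count_measure vgroup_def)
  have cyl_P: "vcyl m n x = {y \<in> space ?P. \<forall>i\<in>{..<n}. y i \<in> {x i}}" for n x
    unfolding space_P by (auto simp: vcyl_def)
  have cyl_sets: "vcyl m n x \<in> sets ?P" if "x \<in> vgroup m" for n x
    unfolding cyl_P
  proof (rule sets.sets_Collect_finite_All)
    fix i
    show "{y \<in> space ?P. y i \<in> {x i}} \<in> sets ?P"
      by (intro measurable_sets_Collect[OF measurable_component_singleton, of i])
        (auto simp: sets_uniform_count_measure space_uniform_count_measure)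
  qed simp
  have sets_P: "sets ?P = sigma_sets (vgroup m) (vgen m)"
  proof (rule antisym)
    show "sigma_sets (vgroup m) (vgen m) \<subseteq> sets ?P"
      unfolding space_P[symmetric]
      by (rule sets.sigma_sets_subset) (auto simp: vgen_def cyl_sets)
    have "{f \<in> \<Pi>\<^sub>E i\<in>UNIV. {..<m i}. f i \<in> A} \<in> sigma_sets (vgroup m) (vgen m)"
      if "A \<subseteq> {..<m i}" for i A
    proof -
      let ?U = "{f \<in> \<Pi>\<^sub>E i\<in>UNIV. {..<m i}. f i \<in> A}"
      have "?U = PiE UNIV (\<lambda>k. if k = i then A else {..<m k})"
        using that by (fastforce simp: PiE_iff split: if_splits)
      moreover have "finite {k. (if k = i then A else {..<m k}) \<noteq> {..<m k}}"
        by (rule finite_subset[of _ "{i}"]) (auto split: if_splits)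
      ultimately have "openin (vtopology m) ?U"
        using that by (auto simp: vtopology_def openin_PiE_gen)
      then show ?thesis
        unfolding sigma_sets_vtopology[symmetric] by (intro sigma_sets.Basic) simp
    qed
    then have "{{f \<in> vgroup m. f i \<in> A} |i A. i \<in> UNIV \<and> A \<in> Pow {..<m i}}
        \<subseteq> sigma_sets (vgroup m) (vgen m)"
      unfolding vgroup_def[symmetric] by blast
    then show "sets ?P \<subseteq> sigma_sets (vgroup m) (vgen m)"
      unfolding sets_PiM_single space_uniform_count_measure sets_uniform_count_measure
        vgroup_def[symmetric]
      by (rule sigma_sets_mono)
  qed
  have em_P: "emeasure ?P (vcyl m n x) = ennreal (1 / vM m n)" if x: "x \<in> vgroup m" for n x
  proof -
    have "emeasure ?P (vcyl m n x) = (\<Prod>i<n. emeasure (uniform_count_measure {..<m i}) {x i})"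
      unfolding cyl_P using x
      by (intro emeasure_PiM_Collect) (auto simp: sets_uniform_count_measure vgroup_iff)
    also have "\<dots> = (\<Prod>i<n. ennreal (1 / m i))"
      using x by (intro prod.cong refl, subst emeasure_uniform_count_measure) (auto simp: vgroup_iff)
    also have "\<dots> = ennreal (1 / vM m n)"
      by (simp add: prod_ennreal vM_def prod_dividef)
    finally show ?thesis .
  qed
  show ?thesis
  proof
    assume h: "haar_prob m \<mu>"
    show "\<mu> = ?P"
      using h haar_prob_vcyl[OF m h] em_P
      by (intro vgen_measure_eqI[OF _ sets_P m])
        (auto simp: haar_prob_def sigma_sets_vtopology)
  next
    have inv: "emeasure ?P (vadd m a ` A) = emeasure ?P A"
      if a: "a \<in> vgroup m" and A: "A \<in> sets ?P" for a A
    proof -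
      let ?b = "vneg m a"
      have meas: "vadd m ?b \<in> measurable ?P ?P"
      proof (rule measurable_sigma_sets[OF sets_P vgen_Pow])
        show "vadd m ?b \<in> space ?P \<rightarrow> vgroup m" using vadd_closed[OF m] by auto
        show "vadd m ?b -` B \<inter> space ?P \<in> sets ?P" if B: "B \<in> vgen m" for B
          using B cyl_sets[OF vadd_closed[OF m]] vadd_image[OF m a, symmetric] vadd_vcyl[OF m a]
            vcyl_subset
          by (auto simp: vgen_def space_P)
      qed
      have "distr ?P ?P (vadd m ?b) = ?P"
      proof (rule vgen_measure_eqI[OF _ sets_P m _ em_P])
        fix n x assume x: "x \<in> vgroup m"
        have "emeasure (distr ?P ?P (vadd m ?b)) (vcyl m n x) = emeasure ?P (vcyl m n (vadd m a x))"
          using meas cyl_sets[OF x]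
          by (simp add: emeasure_distr space_P vadd_image[OF m a vcyl_subset, symmetric]
              vadd_vcyl[OF m a x])
        then show "emeasure (distr ?P ?P (vadd m ?b)) (vcyl m n x) = ennreal (1 / vM m n)"
          using em_P[OF vadd_closed[OF m]] by simp
      qed (simp_all add: sets_P)
      then have "emeasure ?P A = emeasure (distr ?P ?P (vadd m ?b)) A" by simp
      also have "\<dots> = emeasure ?P (vadd m a ` A)"
        using meas A sets.sets_into_space[OF A]
        by (simp add: emeasure_distr space_P vadd_image[OF m a])
      finally show ?thesis by simp
    qed
    assume \<mu>: "\<mu> = ?P"
    have "emeasure ?P (vgroup m) = 1"
      using emeasure_space_1 space_P by simp
    then show "haar_prob m \<mu>"
      using inv unfolding \<mu> haar_prob_def sigma_sets_vtopology sets_P[symmetric] space_P by blast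
  qed
qed

end

theory Submission
  imports Defs
begin

text \<open>
  A stopping-time argument writes a martingale of \<open>H\<^sub>1\<^sub>/\<^sub>2\<close> as a sum of pieces, each supported on a
  cylinder \<open>I\<close> of some level \<open>N\<close>, bounded by some \<open>A\<close> and (if \<open>N > 0\<close>) of mean zero, with
  \<open>\<Sum> A\<^sup>1\<^sup>/\<^sup>2 \<mu>(I)\<close> controlled by \<open>\<integral> (f\<^sup>*)\<^sup>1\<^sup>/\<^sup>2 d\<mu>\<close>. As \<open>\<bar>u + v\<bar>\<^sup>1\<^sup>/\<^sup>2 \<le> \<bar>u\<bar>\<^sup>1\<^sup>/\<^sup>2 + \<bar>v\<bar>\<^sup>1\<^sup>/\<^sup>2\<close>, it is
  enough to bound the logarithmic mean of one piece \<open>a\<close> by \<open>c A\<^sup>1\<^sup>/\<^sup>2 \<mu>(I)\<close>. Since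
  \<open>\<sigma>\<^sub>k a = 0\<close> for \<open>k \<le> M\<^sub>N\<close>, only \<open>k \<ge> M\<^sub>N\<close> matters. At points of \<open>I\<close>, and at points
  which differ from \<open>I\<close> in one digit below \<open>N\<close> only, \<open>\<sigma>\<^sub>k a\<close> is estimated in \<open>L\<^sub>2\<close> by Parseval. If
  \<open>s < l < N\<close> are the first two digits in which a point differs from \<open>I\<close>, the sums of
  characters collapse twice and give \<open>\<bar>\<sigma>\<^sub>k a\<bar> \<le> c A M\<^sub>s M\<^sub>l / (k M\<^sub>N)\<close>. Altogether
  \<open>\<integral> \<bar>\<sigma>\<^sub>k a\<bar>\<^sup>1\<^sup>/\<^sup>2 d\<mu> \<le> c A\<^sup>1\<^sup>/\<^sup>2 \<mu>(I) (1 + N (M\<^sub>N / k)\<^sup>1\<^sup>/\<^sup>2)\<close>; summing against \<open>1 / k\<close> over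
  \<open>M\<^sub>N \<le> k \<le> n\<close> gives \<open>O(log n + N)\<close>, and \<open>N \<le> log\<^sub>2 n\<close>.
\<close>

section \<open>Elementary sums\<close>

text \<open>A geometric sum whose ratio is an \<open>n\<close>-th root of unity, equal to 1 only
  when \<open>a = b\<close>: the orthogonality of the characters in one digit.\<close>

lemma sum_root_of_unity_powers:
  fixes a b n :: nat
  assumes "a < n" "b < n"
  defines "w \<equiv> \<lambda>a. exp (2 * of_real pi * \<i> * of_nat a / of_nat n) :: complex"
  shows "(\<Sum>u<n. (w a * cnj (w b)) ^ u) = (if a = b then of_nat n else 0)"
proof -
  have n: "1 \<le> n" using assms by simp
  have norm: "cmod (w c) = 1" for c
    by (simp add: w_def)
  have inv: "w c * cnj (w c) = 1" for c
    using norm[of c] by (simp add: complex_norm_square[symmetric])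
  have pow: "w c ^ n = 1" for c
    using complex_root_unity[of n c] n by (simp add: w_def)
  show ?thesis
  proof (cases "a = b")
    case False
    have "w a \<noteq> w b"
      using complex_root_unity_eq[OF n, of a b] False assms(1,2) by (simp add: w_def)
    then have "w a * cnj (w b) \<noteq> 1"
      using inv[of b] by (metis mult.commute mult_cancel_right mult_zero_right zero_neq_one)
    moreover have "(w a * cnj (w b)) ^ n = 1"
      by (simp add: power_mult_distrib pow complex_cnj_power[symmetric] del: complex_cnj_power)
    ultimately show ?thesis
      using False by (simp add: sum_gp_strict)
  qed (simp add: inv)
qed

text \<open>Complete blocks of length \<open>M\<close> plus one incomplete block. When
  \<open>M\<close> is some \<open>vM m l\<close>, characters factor on each block.\<close>

lemma sum_lessThan_div_mod:
  fixes j M :: nat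
  assumes "0 < M"
  shows "(\<Sum>i<j. h i) = (\<Sum>p<j div M. \<Sum>i<M. h (i + M * p)) + (\<Sum>i<j mod M. h (i + M * (j div M)))"
proof -
  have shift: "(\<Sum>i\<in>{c..<c + n}. h i) = (\<Sum>i<n. h (i + c))" for c n :: nat
    using sum.shift_bounds_nat_ivl[of h 0 c n] by (simp add: atLeast0LessThan add.commute)
  have "{..<j} = {..<j div M * M} \<union> {j div M * M..<j div M * M + j mod M}"
    by (auto simp: not_less intro: less_le_trans[OF _ div_times_less_eq_dividend])
  then have "(\<Sum>i<j. h i) = (\<Sum>i<j div M * M. h i) + (\<Sum>i\<in>{j div M * M..<j div M * M + j mod M}. h i)"
    by (metis finite_atLeastLessThan finite_lessThan ivl_disj_int_one(2) sum.union_disjoint)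
  also have "(\<Sum>i<j div M * M. h i) = (\<Sum>p<j div M. \<Sum>i\<in>{p * M..<p * M + M}. h i)"
    by (rule sum.nat_group[symmetric])
  finally show ?thesis
    unfolding shift by (simp add: mult.commute)
qed

lemma sum_UN_le:
  fixes h :: "'a \<Rightarrow> real"
  assumes "finite T" "\<And>i. i \<in> T \<Longrightarrow> finite (F i)" "\<And>x. 0 \<le> h x"
  shows "sum h (\<Union>i\<in>T. F i) \<le> (\<Sum>i\<in>T. sum h (F i))"
  using assms(1,2)
proof (induction T rule: finite_induct)
  case (insert i T)
  have "sum h (F i \<union> (\<Union>i\<in>T. F i)) + sum h (F i \<inter> (\<Union>i\<in>T. F i)) = sum h (F i) + sum h (\<Union>i\<in>T. F i)"
    using insert.hyps(1) insert.prems by (intro sum.union_inter) auto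
  moreover have "0 \<le> sum h (F i \<inter> (\<Union>i\<in>T. F i))"
    by (intro sum_nonneg assms(3))
  ultimately show ?case
    using insert.IH insert.prems insert.hyps by (simp only: UN_insert sum.insert) fastforce
qed simp

text \<open>Takes the place of Hoelder's inequality: through
  \<open>sqrt v \<le> sqrt A * (1 + (v / A)^2)\<close>, an L_2 bound on a set of bounded size
  controls the square roots.\<close>

lemma sum_sqrt_le:
  fixes h :: "'a \<Rightarrow> real"
  assumes "0 < A" "real (card S) \<le> c" "(\<Sum>x\<in>S. (h x)\<^sup>2) \<le> c * A\<^sup>2" "\<And>x. 0 \<le> h x"
  shows "(\<Sum>x\<in>S. sqrt (h x)) \<le> 2 * c * sqrt A"
proof -
  have pt: "sqrt v \<le> sqrt A * (1 + v\<^sup>2 / A\<^sup>2)" if "0 \<le> v" for v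
  proof -
    have "sqrt (v / A) \<le> 1 + (v / A)\<^sup>2"
    proof (cases "v / A \<le> 1")
      case True
      then have "sqrt (v / A) \<le> 1" by simp
      then show ?thesis using zero_le_power2[of "v / A"] by linarith
    next
      case False
      then have 1: "v / A \<le> (v / A)\<^sup>2"
        using power_increasing[of 1 2 "v / A"] by simp
      moreover have "sqrt (v / A) \<le> v / A"
        using that assms(1) 1 by (intro real_le_lsqrt) auto
      ultimately have "sqrt (v / A) \<le> (v / A)\<^sup>2" by linarith
      then show ?thesis by linarith
    qed
    then have "sqrt A * sqrt (v / A) \<le> sqrt A * (1 + (v / A)\<^sup>2)"
      using assms(1) by (intro mult_left_mono) auto
    then show ?thesis
      using assms(1) by (simp add: real_sqrt_mult[symmetric] power_divide)
  qed
  have "(\<Sum>x\<in>S. sqrt (h x)) \<le> (\<Sum>x\<in>S. sqrt A * (1 + (h x)\<^sup>2 / A\<^sup>2))"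
    by (intro sum_mono pt assms(4))
  also have "\<dots> = sqrt A * (card S + (\<Sum>x\<in>S. (h x)\<^sup>2) / A\<^sup>2)"
    by (simp add: sum_distrib_left[symmetric] sum.distrib sum_divide_distrib[symmetric])
  also have "\<dots> \<le> sqrt A * (c + c)"
    using assms(1-3) by (intro mult_left_mono add_mono) (auto simp: divide_le_eq)
  finally show ?thesis by (simp add: mult_ac)
qed

text \<open>The term \<open>- 2 / sqrt n\<close>, a primitive of x^(-3/2), closes the induction; the
  step rests on \<open>v - u = 1 / (v + u)\<close>.\<close>

lemma sum_inverse_sqrt_tail:
  assumes "1 \<le> a" "a \<le> n"
  shows "(\<Sum>k=a..n. 1 / (real k * sqrt k)) \<le> 3 / sqrt a - 2 / sqrt n"
  using assms(2)
proof (induction n rule: dec_induct)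
  case base
  have "1 / (real a * sqrt a) \<le> 1 / sqrt a"
    using assms(1) by (intro divide_left_mono) auto
  then show ?case by simp
next
  case (step n)
  define u v where "u = sqrt (real n)" and "v = sqrt (real (Suc n))"
  have uv: "0 < u" "u \<le> v" "v\<^sup>2 - u\<^sup>2 = 1" "v * v = real (Suc n)"
    using assms(1) step by (auto simp: u_def v_def)
  have "u * v * (v + u) \<le> u * v * (v + v)"
    using uv by (intro mult_left_mono) auto
  also have "\<dots> = 2 * (v * v) * u" by simp
  finally have a: "u * v * (v + u) \<le> 2 * (v * v) * u" .
  have b: "2 / u - 2 / v = 2 * (v - u) / (u * v)"
    using uv(1,2) by (simp add: field_simps)
  have c: "(v - u) * (v + u) = 1"
    using uv(3) by (simp add: power2_eq_square algebra_simps)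
  have "1 / ((v * v) * v) \<le> 2 / u - 2 / v"
  proof -
    have vu: "v - u = 1 / (v + u)" using c uv by (simp add: field_simps)
    have "2 / u - 2 / v = 2 / (u * v * (v + u))" unfolding b vu using uv by (simp add: field_simps)
    also have "\<dots> \<ge> 2 / (2 * (v * v) * v)"
    proof (intro divide_left_mono)
      have "2 * (v * v) * u \<le> 2 * (v * v) * v" using uv by (intro mult_left_mono) auto
      with a show "u * v * (v + u) \<le> 2 * (v * v) * v" by linarith
    qed (use uv in auto)
    finally show ?thesis by simp
  qed
  with uv(4) have "1 / (real (Suc n) * sqrt (Suc n)) \<le> 2 / sqrt n - 2 / sqrt (Suc n)"
    by (simp add: u_def v_def)
  with step show ?case by simp
qed

lemma harmonic_sum_le: "1 \<le> n \<Longrightarrow> (\<Sum>k=1..n. 1 / real k) \<le> 1 + ln n"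
  using euler_mascheroni_sequence_decreasing[of 1 n] by (simp add: harm_def inverse_eq_divide)

lemma half_le_ln:
  assumes "2 \<le> (n::nat)"
  shows "1 / 2 \<le> ln (real n)"
proof -
  have "ln 2 \<le> ln (real n)" using assms by simp
  then show ?thesis using ln2_ge_two_thirds by linarith
qed

lemma sum_partial_sums:
  fixes h :: "nat \<Rightarrow> complex"
  shows "(\<Sum>j=1..k. \<Sum>i<j. h i) = (\<Sum>i<k. of_nat (k - i) * h i)"
proof (induction k)
  case (Suc k)
  have "(\<Sum>i<Suc k. of_nat (Suc k - i) * h i) = (\<Sum>i<Suc k. of_nat (k - i) * h i + h i)"
    by (intro sum.cong refl) (simp add: Suc_diff_le algebra_simps)
  then show ?case using Suc by (simp add: sum.distrib)
qed simp

text \<open>The counted terms begin a geometric progression, so they add up to at most twice the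
  largest one, which is below \<open>v\<close>. Used to sum over the dyadic heights exceeded at a
  point.\<close>

lemma sum_dyadic_below_le:
  fixes e v :: real
  assumes "0 < e" "0 \<le> v"
  shows "(\<Sum>j<J. if e * 2 ^ j < v then e * 2 ^ j else 0) \<le> 2 * v"
proof (induction J)
  case (Suc J)
  show ?case
  proof (cases "e * 2 ^ J < v")
    case True
    have "(\<Sum>j<Suc J. if e * 2 ^ j < v then e * 2 ^ j else 0) \<le> (\<Sum>j<Suc J. e * 2 ^ j)"
      using assms(1) by (intro sum_mono) auto
    also have "\<dots> \<le> e * 2 ^ Suc J"
      using assms(1) by (induction J) auto
    also have "\<dots> \<le> 2 * v" using True by simp
    finally show ?thesis .
  qed (use Suc in simp)
qed (use assms in simp)

section \<open>Characters\<close>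

locale vilenkin =
  fixes m :: "nat \<Rightarrow> nat"
  assumes m2: "\<forall>k. 2 \<le> m k"
begin

abbreviation "M \<equiv> vM m"
abbreviation "\<psi> \<equiv> vpsi m"
abbreviation "G \<equiv> vgroup m"
abbreviation "X \<equiv> vrep m"

lemma m_gr0 [simp]: "0 < m k"
  using m2 by (rule m_pos)

lemma M_gr0 [simp]: "0 < M k"
  using vM_ge[OF m2, of k] by simp

lemma M_ge_1: "1 \<le> M k"
  using M_gr0[of k] by linarith

lemma M_nonzero [simp]: "M k \<noteq> 0"
  using M_gr0[of k] by simp

lemma M_dvd: "s \<le> t \<Longrightarrow> M s dvd M t"
  unfolding vM_def by (rule prod_dvd_prod_subset) auto

lemma M_mono: "s \<le> t \<Longrightarrow> M s \<le> M t"
  by (simp add: M_dvd dvd_imp_le)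

lemma two_M_le: "2 * M k \<le> M (Suc k)"
  using m2 by (simp add: vM_Suc)

lemma two_power_le_M: "2 ^ k \<le> M k"
proof (induction k)
  case (Suc k)
  then show ?case using two_M_le[of k] by simp
qed (simp add: vM_0)

section \<open>Digits and characters of sums of indices\<close>

lemma vdigit_less [simp]: "vdigit m i j < m j"
  by (simp add: vdigit_def)

lemma vdigit_zero_high: "i < M j \<Longrightarrow> vdigit m i j = 0"
  by (simp add: vdigit_def)

lemma vdigit_zero_low:
  assumes "M n dvd i" "j < n"
  shows "vdigit m i j = 0"
proof -
  from assms(1) obtain q where q: "i = M n * q" by blast
  from M_dvd[of "Suc j" n] assms(2) obtain r where "M n = M (Suc j) * r" by (auto simp: dvd_def)
  then have "i = M j * (m j * (r * q))" using q by (simp add: vM_Suc mult_ac)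
  then show ?thesis by (simp add: vdigit_def)
qed

lemma vdigit_add_low:
  assumes "j < n"
  shows "vdigit m (i + M n * q) j = vdigit m i j"
proof -
  from M_dvd[of "Suc j" n] assms obtain r where "M n = M (Suc j) * r" by (auto simp: dvd_def)
  then have "i + M n * q = i + M j * (m j * (r * q))" by (simp add: vM_Suc mult_ac)
  then have "(i + M n * q) div M j = i div M j + m j * (r * q)"
    by (metis M_nonzero div_mult_self2 add.commute)
  then show ?thesis unfolding vdigit_def by simp
qed

lemma vdigit_add_high:
  assumes "i < M n" "n \<le> j"
  shows "vdigit m (i + M n * q) j = vdigit m (M n * q) j"
proof -
  from M_dvd[OF assms(2)] obtain r where "M j = M n * r" by (auto simp: dvd_def)
  then show ?thesis
    using assms(1) by (simp add: vdigit_def div_mult2_eq)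
qed

text \<open>The digits of \<open>i\<close> lie below \<open>n\<close> and those of
  \<open>M n * q\<close> from \<open>n\<close> on, so no carry occurs.\<close>

lemma vdigit_add:
  assumes "i < M n"
  shows "vdigit m (i + M n * q) j = vdigit m i j + vdigit m (M n * q) j"
proof (cases "j < n")
  case True
  then show ?thesis by (simp add: vdigit_add_low vdigit_zero_low[of n])
next
  case False
  then have "i < M j" using assms M_mono[of n j] by simp
  with False show ?thesis by (simp add: vdigit_add_high[OF assms] vdigit_zero_high)
qed

lemma psi_eq_prod:
  assumes "i < M n"
  shows "\<psi> i x = (\<Prod>k<n. vrad m k x ^ vdigit m i k)"
  unfolding vpsi_def
proof (rule prod.mono_neutral_left)
  have "vdigit m i k = 0" if "n \<le> k" for k
    using assms M_mono[OF that] by (intro vdigit_zero_high) simp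
  then show "{k. vdigit m i k \<noteq> 0} \<subseteq> {..<n}"
    by (auto intro: not_le_imp_less)
qed auto

text \<open>Characters multiply under digitwise addition of indices, which is ordinary addition here
  for lack of carries.\<close>

lemma psi_add:
  assumes "i < M n"
  shows "\<psi> (i + M n * q) x = \<psi> i x * \<psi> (M n * q) x"
proof -
  \<comment> \<open>A common level for the three indices, as \<open>K < M K\<close>.\<close>
  define K where "K = i + M n * q"
  have le: "i < M K" "M n * q < M K" "i + M n * q < M K"
    using vM_ge[OF m2, of K] by (auto simp: K_def)
  show ?thesis
    unfolding psi_eq_prod[OF le(1)] psi_eq_prod[OF le(2)] psi_eq_prod[OF le(3)]
      vdigit_add[OF assms] power_add prod.distrib ..
qed

lemma psi_M_mult:
  assumes "u < m l"
  shows "\<psi> (M l * u) x = vrad m l x ^ u"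
proof -
  have "M l * u < M (Suc l)" using assms by (simp add: vM_Suc)
  moreover have "vdigit m (M l * u) l = u" using assms by (simp add: vdigit_def)
  moreover have "vdigit m (M l * u) k = 0" if "k < l" for k
    using that by (rule vdigit_zero_low[of l, rotated]) simp
  ultimately show ?thesis
    by (simp add: psi_eq_prod[of _ "Suc l"])
qed

lemma cmod_psi [simp]: "cmod (\<psi> i x) = 1"
  by (simp add: vpsi_def vrad_def prod_norm[symmetric] norm_power)

section \<open>Cylinders and Dirichlet kernels\<close>

definition agree :: "nat \<Rightarrow> (nat \<Rightarrow> nat) \<Rightarrow> (nat \<Rightarrow> nat) \<Rightarrow> bool" where
  "agree n x y \<longleftrightarrow> (\<forall>i<n. x i = y i)"

lemma agree_refl [simp]: "agree n x x"
  and agree_sym: "agree n x y \<Longrightarrow> agree n y x"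
  and agree_trans: "agree n x y \<Longrightarrow> agree n y z \<Longrightarrow> agree n x z"
  and agree_le: "agree n x y \<Longrightarrow> k \<le> n \<Longrightarrow> agree k x y"
  and agree_0 [simp]: "agree 0 x y"
  by (auto simp: agree_def)

lemma psi_cong:
  assumes "i < M n" "agree n x y"
  shows "\<psi> i x = \<psi> i y"
  using assms(2) by (auto simp: psi_eq_prod[OF assms(1)] vrad_def agree_def)

text \<open>For \<open>s = 0\<close> the Dirichlet kernel, written in two points instead of their
  difference. A general \<open>s\<close> keeps only the characters that ignore the digits below
  \<open>s\<close>.\<close>

definition dir :: "nat \<Rightarrow> nat \<Rightarrow> (nat \<Rightarrow> nat) \<Rightarrow> (nat \<Rightarrow> nat) \<Rightarrow> complex" where
  "dir s j x y = (\<Sum>i<j. if M s dvd i then \<psi> i x * cnj (\<psi> i y) else 0)"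

text \<open>Indices \<open>i + M l * p\<close> with \<open>p < m l\<close> make the sum factor, and
  the factor over \<open>p\<close> sums the powers of one root of unity. As \<open>M s\<close>
  divides \<open>M l\<close>, divisibility depends on \<open>i\<close> only.\<close>

lemma dir_M_Suc:
  assumes "s \<le> l" "x l < m l" "y l < m l"
  shows "dir s (M (Suc l)) x y = dir s (M l) x y * (if x l = y l then of_nat (m l) else 0)"
proof -
  have dvd: "M s dvd i + M l * p \<longleftrightarrow> M s dvd i" for i p
    using M_dvd[OF assms(1)] by (metis dvd_add_left_iff dvd_mult2)
  have "dir s (M (Suc l)) x y = (\<Sum>p<m l. \<Sum>i<M l. if M s dvd i then
      \<psi> i x * cnj (\<psi> i y) * (vrad m l x * cnj (vrad m l y)) ^ p else 0)"
    unfolding dir_def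
    by (subst sum_lessThan_div_mod[OF M_gr0[of l], of _ "M (Suc l)"]) (auto simp: vM_Suc dvd psi_add psi_M_mult power_mult_distrib intro!: sum.cong)
  also have "\<dots> = dir s (M l) x y * (\<Sum>p<m l. (vrad m l x * cnj (vrad m l y)) ^ p)"
    unfolding dir_def sum_distrib_left sum_distrib_right by (intro sum.cong refl) auto
  also have "(\<Sum>p<m l. (vrad m l x * cnj (vrad m l y)) ^ p) = (if x l = y l then of_nat (m l) else 0)"
    unfolding vrad_def using assms(2,3) by (rule sum_root_of_unity_powers)
  finally show ?thesis .
qed

text \<open>Paley's formula: the kernel of order \<open>M n\<close> is \<open>M n\<close> times the
  indicator of a cylinder.\<close>

lemma dir_M:
  assumes "x \<in> G" "y \<in> G"
  shows "dir 0 (M n) x y = (if agree n x y then of_nat (M n) else 0)"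
proof (induction n)
  case 0
  have "\<psi> 0 x = 1" "\<psi> 0 y = 1" using psi_eq_prod[of 0 0] by simp_all
  then show ?case by (simp add: dir_def vM_0)
next
  case (Suc n)
  have "dir 0 (M (Suc n)) x y = dir 0 (M n) x y * (if x n = y n then of_nat (m n) else 0)"
    using assms by (intro dir_M_Suc) (auto simp: vgroup_iff)
  with Suc show ?case
    by (auto simp: agree_def less_Suc_eq vM_Suc)
qed

lemma card_dvd_less:
  assumes "s \<le> n"
  shows "real (card {i. i < M n \<and> M s dvd i}) = M n / M s"
proof -
  from M_dvd[OF assms] obtain r where r: "M n = M s * r" by (auto simp: dvd_def)
  have "{i. i < M n \<and> M s dvd i} = (\<lambda>p. M s * p) ` {..<r}"
    using r by auto
  moreover have "inj_on (\<lambda>p. M s * p) {..<r}" by (rule inj_onI) simp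
  ultimately show ?thesis using r by (simp add: card_image)
qed

lemma cmod_dir_le:
  assumes "s \<le> n" "j \<le> M n"
  shows "cmod (dir s j x y) \<le> M n / M s"
proof -
  have "cmod (dir s j x y) \<le> (\<Sum>i<j. if M s dvd i then 1 else 0)"
    unfolding dir_def by (rule sum_norm_le) (auto simp: norm_mult)
  also have "\<dots> \<le> (\<Sum>i<M n. if M s dvd i then 1 else 0)"
    using assms(2) by (intro sum_mono2) auto
  also have "\<dots> = real (card {i. i < M n \<and> M s dvd i})"
    by (simp add: sum.If_cases Int_def)
  finally show ?thesis using card_dvd_less[OF assms(1)] by simp
qed

text \<open>The cancellation over a full period of digit \<open>l\<close> that makes Fourier sums
  collapse.\<close>

lemma dir_vanish:
  assumes "s \<le> l" "x l < m l" "y l < m l" "x l \<noteq> y l"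
  shows "dir s (M (Suc l)) x y = 0"
  using dir_M_Suc[of s l x y] assms by simp

section \<open>Counting and orthogonality over representatives\<close>

lemma X_subset: "X n \<subseteq> G"
  using m2 by (rule vrep_subset)

lemma sum_X_prod:
  fixes w :: "nat \<Rightarrow> nat \<Rightarrow> 'c::comm_semiring_1"
  assumes "z \<in> G" "T \<subseteq> {..<L}"
  shows "(\<Sum>x | x \<in> X L \<and> (\<forall>i\<in>T. x i = z i). \<Prod>k<L. w k (x k)) =
    (\<Prod>k<L. \<Sum>v\<in>(if k \<in> T then {z k} else {..<m k}). w k v)"
proof -
  let ?e = "\<lambda>r k. if k < L then r k else (0::nat)"
  let ?S = "\<Pi>\<^sub>E k\<in>{..<L}. if k \<in> T then {z k} else {..<m k}"
  have "inj_on ?e ?S"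
    by (rule inj_onI, rule PiE_ext) (auto simp: fun_eq_iff, metis)
  moreover have "{x. x \<in> X L \<and> (\<forall>i\<in>T. x i = z i)} = ?e ` ?S"
  proof (intro set_eqI iffI)
    fix x assume "x \<in> {x. x \<in> X L \<and> (\<forall>i\<in>T. x i = z i)}"
    then obtain r where "x = ?e r" "r \<in> (\<Pi>\<^sub>E k\<in>{..<L}. {..<m k})" "\<forall>i\<in>T. x i = z i"
      by (auto simp: vrep_def)
    then show "x \<in> ?e ` ?S" using assms(2)
      by (intro image_eqI[of _ _ r]) (auto simp: PiE_iff split: if_splits)
  next
    fix x assume "x \<in> ?e ` ?S"
    then obtain r where "x = ?e r" and r: "r \<in> ?S" by auto
    moreover have "r \<in> (\<Pi>\<^sub>E k\<in>{..<L}. {..<m k})"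
      using r by (rule subsetD[OF PiE_mono, rotated]) (use assms(1) in \<open>auto simp: vgroup_iff\<close>)
    moreover have "r i = z i" if "i \<in> T" for i
      using r that assms(2) by (auto simp: PiE_iff split: if_splits)
    ultimately show "x \<in> {x. x \<in> X L \<and> (\<forall>i\<in>T. x i = z i)}"
      using assms(2) by (auto simp: vrep_def)
  qed
  ultimately have "(\<Sum>x | x \<in> X L \<and> (\<forall>i\<in>T. x i = z i). \<Prod>k<L. w k (x k)) =
      (\<Sum>r\<in>?S. \<Prod>k<L. w k (?e r k))"
    by (simp add: sum.reindex)
  also have "\<dots> = (\<Sum>r\<in>?S. \<Prod>k<L. w k (r k))"
    by simp
  also have "\<dots> = (\<Prod>k<L. \<Sum>v\<in>(if k \<in> T then {z k} else {..<m k}). w k v)"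
    by (rule prod_sum_PiE[symmetric]) auto
  finally show ?thesis .
qed

lemma card_X_fixed:
  assumes "z \<in> G" "T \<subseteq> {..<L}"
  shows "card {x. x \<in> X L \<and> (\<forall>i\<in>T. x i = z i)} = (\<Prod>k<L. if k \<in> T then 1 else m k)"
  using sum_X_prod[OF assms, of "\<lambda>_ _. 1::nat"]
  by (auto intro!: prod.cong)

lemma prod_split_M:
  assumes "s \<le> L"
  shows "(\<Prod>k<L. if k < s then 1 else m k) * M s = M L"
proof -
  have "{..<L} = {..<s} \<union> {s..<L}" using assms by auto
  then have *: "prod h {..<L} = prod h {..<s} * prod h {s..<L}" for h :: "nat \<Rightarrow> nat"
    by (metis finite_atLeastLessThan finite_lessThan ivl_disj_int_one(2) prod.union_disjoint)
  show ?thesis unfolding vM_def * by simp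
qed

lemma card_agree:
  assumes "z \<in> G" "s \<le> L"
  shows "real (card {x \<in> X L. agree s x z}) = M L / M s"
proof -
  have "card {x. x \<in> X L \<and> (\<forall>i\<in>{..<s}. x i = z i)} * M s = M L"
    using card_X_fixed[OF assms(1), of "{..<s}" L] prod_split_M[OF assms(2)] assms(2) by simp
  then have "card {x \<in> X L. agree s x z} * M s = M L"
    by (simp add: agree_def Ball_def)
  then have "real (card {x \<in> X L. agree s x z}) * M s = M L"
    unfolding of_nat_mult[symmetric] by (rule arg_cong)
  then show ?thesis by (simp add: field_simps)
qed

lemma card_agree_except:
  assumes "z \<in> G" "s < l" "l \<le> L"
  shows "real (card {x \<in> X L. \<forall>i<l. i \<noteq> s \<longrightarrow> x i = z i}) = m s * (M L / M l)"
proof -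
  let ?T = "{..<l} - {s}"
  have "card {x. x \<in> X L \<and> (\<forall>i\<in>?T. x i = z i)} * M l = (\<Prod>k<L. if k \<in> ?T then 1 else m k) * M l"
    using assms(3) by (subst card_X_fixed[OF assms(1)]) auto
  also have "(\<Prod>k<L. if k \<in> ?T then 1 else m k) = (\<Prod>k<L. (if k < l then 1 else m k) * (if k = s then m s else 1))"
    using assms(2) by (intro prod.cong) auto
  also have "\<dots> = (\<Prod>k<L. if k < l then 1 else m k) * m s"
    using assms(2,3) by (simp add: prod.distrib prod.delta)
  also have "\<dots> * M l = m s * M L"
    using prod_split_M[OF assms(3)] by simp
  finally have "card {x. x \<in> X L \<and> (\<forall>i\<in>?T. x i = z i)} * M l = m s * M L" .
  then have "real (card {x. x \<in> X L \<and> (\<forall>i\<in>?T. x i = z i)}) * M l = m s * M L"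
    unfolding of_nat_mult[symmetric] by (rule arg_cong)
  moreover have "{x. x \<in> X L \<and> (\<forall>i\<in>?T. x i = z i)} = {x \<in> X L. \<forall>i<l. i \<noteq> s \<longrightarrow> x i = z i}"
    by auto
  ultimately show ?thesis by (simp add: field_simps)
qed

text \<open>The sum factors over digits. Below \<open>s\<close> both characters are trivial, their
  indices being multiples of \<open>M s\<close>; from \<open>s\<close> on each digit contributes
  \<open>m k\<close> or 0. So these characters are orthogonal on each cylinder of level
  \<open>s\<close>.\<close>

lemma sum_psi_orthogonal:
  assumes z: "z \<in> G" and sL: "s \<le> L" and i: "i < M L" "M s dvd i" and j: "j < M L" "M s dvd j"
  shows "(\<Sum>x | x \<in> X L \<and> agree s x z. \<psi> i x * cnj (\<psi> j x)) = (if i = j then of_nat (M L) / of_nat (M s) else 0)"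
proof -
  let ?w = "\<lambda>k v. exp (2 * of_real pi * \<i> * of_nat v / of_nat (m k)) :: complex"
  let ?h = "\<lambda>k v. ?w k v ^ vdigit m i k * cnj (?w k v ^ vdigit m j k)"
  \<comment> \<open>Exchanges the digit of the point with that of the index, so that the summation
    variable becomes the exponent of a fixed root of unity.\<close>
  have w: "?w k v ^ u = ?w k u ^ v" for k v u
    by (simp only: exp_of_nat_mult[symmetric]) (simp add: mult_ac)
  have "(\<Sum>x | x \<in> X L \<and> agree s x z. \<psi> i x * cnj (\<psi> j x)) =
      (\<Sum>x | x \<in> X L \<and> (\<forall>k\<in>{..<s}. x k = z k). \<Prod>k<L. ?h k (x k))"
    by (intro sum.cong) (auto simp: psi_eq_prod[OF i(1)] psi_eq_prod[OF j(1)] vrad_def agree_def prod.distrib)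
  also have "\<dots> = (\<Prod>k<L. \<Sum>v\<in>(if k \<in> {..<s} then {z k} else {..<m k}). ?h k v)"
    by (rule sum_X_prod[OF z]) (use sL in auto)
  also have "\<dots> = (\<Prod>k<L. if k < s then 1 else if vdigit m i k = vdigit m j k then of_nat (m k) else 0)"
  proof (intro prod.cong refl)
    fix k
    have *: "(\<Sum>v<m k. ?h k v) = (if vdigit m i k = vdigit m j k then of_nat (m k) else 0)"
    proof -
      have "(\<Sum>v<m k. ?h k v) = (\<Sum>v<m k. (?w k (vdigit m i k) * cnj (?w k (vdigit m j k))) ^ v)"
        unfolding power_mult_distrib complex_cnj_power[symmetric]
        by (intro sum.cong refl arg_cong2[of _ _ _ _ "(*)"] arg_cong[of _ _ cnj] w)
      then show ?thesis using sum_root_of_unity_powers[OF vdigit_less vdigit_less, of i k j] by simp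
    qed
    show "(\<Sum>v\<in>(if k \<in> {..<s} then {z k} else {..<m k}). ?h k v) =
        (if k < s then 1 else if vdigit m i k = vdigit m j k then of_nat (m k) else 0)"
      using * by (simp add: vdigit_zero_low[OF i(2)] vdigit_zero_low[OF j(2)])
  qed
  also have "\<dots> = (if i = j then of_nat (M L) / of_nat (M s) else 0)"
  proof (cases "i = j")
    case True
    have "(\<Prod>k<L. if k < s then 1 else of_nat (m k) :: complex) = of_nat (\<Prod>k<L. if k < s then 1 else m k)"
      unfolding of_nat_prod by (intro prod.cong) auto
    then have "(\<Prod>k<L. if k < s then 1 else of_nat (m k) :: complex) * of_nat (M s) = of_nat (M L)"
      using prod_split_M[OF sL] by (metis of_nat_mult)
    moreover have "(\<Prod>k<L. if k < s then 1 else if vdigit m i k = vdigit m j k then of_nat (m k) else 0) =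
        (\<Prod>k<L. if k < s then 1 else of_nat (m k) :: complex)"
      using True by (simp cong: if_cong)
    ultimately show ?thesis using True by (simp only: if_True) (simp add: nonzero_eq_divide_eq)
  next
    case False
    have "i = (\<Sum>k<L. vdigit m i k * M k)" "j = (\<Sum>k<L. vdigit m j k * M k)"
      using vdigit_sum[of m i L] vdigit_sum[of m j L] i j by simp_all
    \<comment> \<open>Distinct indices below \<open>M L\<close> differ in some digit, and its factor
      vanishes.\<close>
    then obtain k where "k < L" "vdigit m i k \<noteq> vdigit m j k"
      using False by (metis (mono_tags, lifting) lessThan_iff sum.cong)
    moreover from this have "\<not> k < s"
      using vdigit_zero_low[OF i(2)] vdigit_zero_low[OF j(2)] by auto
    ultimately show ?thesis using False by (auto intro!: prod_zero)
  qed
  finally show ?thesis .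
qed

lemma parseval_cylinder:
  assumes "z \<in> G" "s \<le> L" "\<And>i. i \<in> A \<Longrightarrow> i < M L \<and> M s dvd i"
  shows "(\<Sum>x | x \<in> X L \<and> agree s x z. (cmod (\<Sum>i\<in>A. c i * \<psi> i x))\<^sup>2) = M L / M s * (\<Sum>i\<in>A. (cmod (c i))\<^sup>2)"
proof -
  have "finite A" using assms(3) by (meson finite_nat_iff_bounded lessThan_iff subsetI)
  have "complex_of_real (\<Sum>x | x \<in> X L \<and> agree s x z. (cmod (\<Sum>i\<in>A. c i * \<psi> i x))\<^sup>2) =
     (\<Sum>x | x \<in> X L \<and> agree s x z. \<Sum>i\<in>A. \<Sum>j\<in>A. c i * cnj (c j) * (\<psi> i x * cnj (\<psi> j x)))"
    unfolding of_real_sum complex_norm_square cnj_sum sum_product complex_cnj_mult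
    by (intro sum.cong refl) (simp add: mult_ac)
  also have "\<dots> = (\<Sum>i\<in>A. \<Sum>j\<in>A. c i * cnj (c j) * (\<Sum>x | x \<in> X L \<and> agree s x z. \<psi> i x * cnj (\<psi> j x)))"
    unfolding sum_distrib_left
    by (subst sum.swap, intro sum.cong refl, subst sum.swap, rule refl)
  also have "\<dots> = (\<Sum>i\<in>A. \<Sum>j\<in>A. if i = j then c i * cnj (c i) * (of_nat (M L) / of_nat (M s)) else 0)"
    by (intro sum.cong refl, subst sum_psi_orthogonal[OF assms(1,2)]) (use assms(3) in auto)
  also have "\<dots> = (\<Sum>i\<in>A. c i * cnj (c i) * (of_nat (M L) / of_nat (M s)))"
    using \<open>finite A\<close> by (simp add: sum.delta)
  also have "\<dots> = complex_of_real (M L / M s * (\<Sum>i\<in>A. (cmod (c i))\<^sup>2))"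
    by (simp only: sum_distrib_right[symmetric] complex_norm_square[symmetric] of_real_sum[symmetric])
       (simp add: mult.commute)
  finally show ?thesis by (simp only: of_real_eq_iff)
qed

end

section \<open>Fejer means of atoms\<close>

context vilenkin
begin

text \<open>For a function constant on the cylinders of level \<open>L\<close> and
  \<open>i < M L\<close>, this average is the Fourier coefficient for the Haar measure.\<close>

definition fc :: "nat \<Rightarrow> ((nat \<Rightarrow> nat) \<Rightarrow> complex) \<Rightarrow> nat \<Rightarrow> complex" where
  "fc L a i = (\<Sum>x\<in>X L. a x * cnj (\<psi> i x)) / of_nat (M L)"

text \<open>Restricted to the multiples of \<open>M\<^sub>s\<close>, the Fourier sums do not depend on the digits below
  \<open>s\<close>; \<open>s = 0\<close> gives the ordinary partial sums.\<close>

definition psum :: "nat \<Rightarrow> ((nat \<Rightarrow> nat) \<Rightarrow> complex) \<Rightarrow> nat \<Rightarrow> nat \<Rightarrow> (nat \<Rightarrow> nat) \<Rightarrow> complex" where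
  "psum L a s j x = (\<Sum>i<j. if M s dvd i then fc L a i * \<psi> i x else 0)"

definition fej :: "nat \<Rightarrow> ((nat \<Rightarrow> nat) \<Rightarrow> complex) \<Rightarrow> nat \<Rightarrow> (nat \<Rightarrow> nat) \<Rightarrow> complex" where
  "fej L a k x = (\<Sum>j=1..k. psum L a 0 j x) / of_nat k"

lemma finite_X [simp]: "finite (X n)"
  by (rule finite_vrep)

lemma X_G: "x \<in> X n \<Longrightarrow> x \<in> G"
  using X_subset by blast

lemma X_beyond: "x \<in> X L \<Longrightarrow> L \<le> k \<Longrightarrow> x k = 0"
  unfolding vrep_def by (elim imageE) simp

lemma agree_eq:
  assumes "x \<in> X L" "y \<in> X L"
  shows "agree L x y \<longleftrightarrow> x = y"
proof
  assume "agree L x y"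
  then have "x k = y k" for k
    using X_beyond[OF assms(1), of k] X_beyond[OF assms(2), of k] by (cases "k < L") (auto simp: agree_def)
  then show "x = y" by blast
qed simp

text \<open>Completeness of the first \<open>M L\<close> characters: on \<open>X L\<close> agreement
  up to \<open>L\<close> is equality, so the kernel of order \<open>M L\<close> is
  \<open>M L\<close> times the diagonal.\<close>

lemma parseval_fc: "(\<Sum>i<M L. (cmod (fc L a i))\<^sup>2) = (\<Sum>x\<in>X L. (cmod (a x))\<^sup>2) / M L"
proof -
  let ?c = "of_nat (M L) :: complex"
  have "fc L a i * cnj (fc L a i) = (\<Sum>x\<in>X L. \<Sum>y\<in>X L. a x * cnj (a y) * (\<psi> i y * cnj (\<psi> i x))) / ?c\<^sup>2" for i
  proof -
    have "(\<Sum>x\<in>X L. a x * cnj (\<psi> i x)) * (\<Sum>y\<in>X L. cnj (a y) * \<psi> i y) =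
        (\<Sum>x\<in>X L. \<Sum>y\<in>X L. a x * cnj (a y) * (\<psi> i y * cnj (\<psi> i x)))"
      unfolding sum_product by (intro sum.cong refl) (simp only: mult_ac)
    then show ?thesis by (simp add: fc_def power2_eq_square)
  qed
  then have "complex_of_real (\<Sum>i<M L. (cmod (fc L a i))\<^sup>2) =
      (\<Sum>i<M L. \<Sum>x\<in>X L. \<Sum>y\<in>X L. a x * cnj (a y) * (\<psi> i y * cnj (\<psi> i x)) / ?c\<^sup>2)"
    unfolding of_real_sum complex_norm_square sum_divide_distrib by simp
  also have "\<dots> = (\<Sum>x\<in>X L. \<Sum>y\<in>X L. a x * cnj (a y) * (\<Sum>i<M L. \<psi> i y * cnj (\<psi> i x)) / ?c\<^sup>2)"
    unfolding sum_distrib_left sum_divide_distrib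
    by (subst sum.swap, intro sum.cong refl, subst sum.swap, rule refl)
  also have "\<dots> = (\<Sum>x\<in>X L. \<Sum>y\<in>X L. if x = y then a x * cnj (a x) / ?c else 0)"
  proof (intro sum.cong refl)
    fix x y assume xy: "x \<in> X L" "y \<in> X L"
    have "(\<Sum>i<M L. \<psi> i y * cnj (\<psi> i x)) = dir 0 (M L) y x"
      by (simp add: dir_def vM_0)
    also have "\<dots> = (if x = y then ?c else 0)"
      using dir_M[of y x L] xy agree_eq[OF xy(2,1)] X_G by auto
    finally show "a x * cnj (a y) * (\<Sum>i<M L. \<psi> i y * cnj (\<psi> i x)) / ?c\<^sup>2 = (if x = y then a x * cnj (a x) / ?c else 0)"
      by (auto simp: power2_eq_square)
  qed
  also have "\<dots> = (\<Sum>x\<in>X L. a x * cnj (a x) / ?c)"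
    by (simp add: sum.delta)
  also have "\<dots> = complex_of_real ((\<Sum>x\<in>X L. (cmod (a x))\<^sup>2) / M L)"
    unfolding of_real_divide of_real_sum complex_norm_square sum_divide_distrib by simp
  finally show ?thesis by (simp only: of_real_eq_iff)
qed

text \<open>The Cesaro weights \<open>(k - i) / k\<close> are at most 1, so by Parseval the mean is
  a contraction in L_2.\<close>

lemma fej_L2:
  assumes "k \<le> M L"
  shows "(\<Sum>x\<in>X L. (cmod (fej L a k x))\<^sup>2) \<le> (\<Sum>x\<in>X L. (cmod (a x))\<^sup>2)"
proof -
  have z: "(\<lambda>_. 0) \<in> G" by (simp add: vgroup_iff)
  let ?c = "\<lambda>i. of_nat (k - i) / of_nat k * fc L a i"
  have "fej L a k x = (\<Sum>i<k. ?c i * \<psi> i x)" for x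
  proof -
    have "(\<Sum>j=1..k. psum L a 0 j x) = (\<Sum>i<k. of_nat (k - i) * (fc L a i * \<psi> i x))"
      unfolding sum_partial_sums[symmetric] by (simp add: psum_def vM_0)
    then show ?thesis unfolding fej_def by (simp only: sum_divide_distrib) (simp add: mult_ac)
  qed
  then have "(\<Sum>x\<in>X L. (cmod (fej L a k x))\<^sup>2) = (\<Sum>x | x \<in> X L \<and> agree 0 x (\<lambda>_. 0). (cmod (\<Sum>i<k. ?c i * \<psi> i x))\<^sup>2)"
    by simp
  also have "\<dots> = M L / M 0 * (\<Sum>i<k. (cmod (?c i))\<^sup>2)"
    using assms by (intro parseval_cylinder z) (auto simp: vM_0)
  also have "(\<Sum>i<k. (cmod (?c i))\<^sup>2) \<le> (\<Sum>i<k. (cmod (fc L a i))\<^sup>2)"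
  proof (intro sum_mono power_mono norm_ge_zero)
    fix i assume "i \<in> {..<k}"
    have "cmod (of_nat (k - i) / of_nat k) \<le> 1"
      by (simp add: norm_divide divide_le_eq)
    then show "cmod (?c i) \<le> cmod (fc L a i)"
      by (simp only: norm_mult) (simp add: mult_left_le_one_le)
  qed
  also have "\<dots> \<le> (\<Sum>i<M L. (cmod (fc L a i))\<^sup>2)"
    using assms by (intro sum_mono2) auto
  finally show ?thesis
    by (simp add: parseval_fc vM_0 mult_left_mono)
qed

end

locale vilenkin_bounded = vilenkin +
  fixes B :: nat
  assumes m_le: "m k \<le> B"
begin

lemma B_ge_1: "1 \<le> real B"
  using m_le[of 0] m2 by (metis le_trans of_nat_1 of_nat_le_iff one_le_numeral)

lemma M_Suc_le: "real (M (Suc s)) \<le> B * real (M s)"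
  using m_le[of s] by (simp add: vM_Suc mult_right_mono del: of_nat_mult add: of_nat_mult[symmetric])

end

text \<open>An unnormalised atom, seen through its values on \<open>X L\<close>. The case
  \<open>N = 0\<close>, with arbitrary mean on the whole group, covers the lowest piece of the
  decomposition.\<close>

locale vilenkin_atom = vilenkin_bounded +
  fixes L N :: nat and y :: "nat \<Rightarrow> nat" and A :: real and a :: "(nat \<Rightarrow> nat) \<Rightarrow> complex"
  assumes N_le: "N \<le> L" and y_G: "y \<in> G" and A_pos: "0 < A"
    and a_le: "x \<in> X L \<Longrightarrow> cmod (a x) \<le> A"
    and a_supp: "x \<in> X L \<Longrightarrow> \<not> agree N x y \<Longrightarrow> a x = 0"
    and a_mean: "N = 0 \<or> (\<Sum>x\<in>X L. a x) = 0"
begin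

section \<open>Coefficients of an atom and collapse of its Fourier sums\<close>

abbreviation "I \<equiv> {x \<in> X L. agree N x y}"

lemma card_I: "real (card I) = M L / M N"
  using y_G N_le by (rule card_agree)

lemma sum_a_le: "(\<Sum>x\<in>X L. (cmod (a x)) ^ p) \<le> M L / M N * A ^ p" if "0 < p" for p
proof -
  have "(\<Sum>x\<in>X L. (cmod (a x)) ^ p) = (\<Sum>x\<in>I. (cmod (a x)) ^ p)"
    using a_supp that by (intro sum.mono_neutral_right) auto
  also have "\<dots> \<le> (\<Sum>x\<in>I. A ^ p)"
    using a_le by (intro sum_mono power_mono) auto
  finally show ?thesis by (simp add: card_I)
qed

lemma fc_le: "cmod (fc L a i) \<le> A / M N"
proof -
  have "cmod (\<Sum>x\<in>X L. a x * cnj (\<psi> i x)) \<le> (\<Sum>x\<in>X L. cmod (a x) ^ 1)"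
    by (rule sum_norm_le) (simp add: norm_mult)
  also have "\<dots> \<le> M L / M N * A ^ 1" by (rule sum_a_le) simp
  finally show ?thesis
    by (simp add: fc_def norm_divide field_simps)
qed

text \<open>On the support of \<open>a\<close> the character of index \<open>i\<close> is the
  constant \<open>\<psi> i y\<close>, since \<open>i < M l\<close> and \<open>l \<le> N\<close>.
  Within a block of length \<open>M l\<close> the coefficients thus differ by unimodular
  factors.\<close>

lemma fc_add:
  assumes "l \<le> N" "i < M l"
  shows "fc L a (i + M l * p) = cnj (\<psi> i y) * fc L a (M l * p)"
proof -
  have "a x * cnj (\<psi> (i + M l * p) x) = cnj (\<psi> i y) * (a x * cnj (\<psi> (M l * p) x))" if "x \<in> X L" for x
  proof (cases "agree N x y")
    case True
    then have "\<psi> i x = \<psi> i y"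
      using psi_cong[OF assms(2) agree_le[OF _ assms(1)]] by simp
    then show ?thesis by (simp add: psi_add[OF assms(2)])
  qed (simp add: a_supp[OF that])
  then have "(\<Sum>x\<in>X L. a x * cnj (\<psi> (i + M l * p) x)) = cnj (\<psi> i y) * (\<Sum>x\<in>X L. a x * cnj (\<psi> (M l * p) x))"
    unfolding sum_distrib_left by (rule sum.cong[OF refl])
  then show ?thesis
    by (simp only: fc_def times_divide_eq_right)
qed

lemma fc_zero:
  assumes "N \<noteq> 0" "i < M N"
  shows "fc L a i = 0"
proof -
  have "\<psi> 0 x = 1" for x using psi_eq_prod[of 0 0] by simp
  then have "fc L a (M N * 0) = 0" using a_mean assms(1) by (simp add: fc_def)
  with fc_add[of N i 0] assms(2) show ?thesis by simp
qed

lemma fej_zero: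
  assumes "N \<noteq> 0" "k \<le> M N"
  shows "fej L a k x = 0"
  using fc_zero[OF assms(1)] assms(2) by (auto simp: fej_def psum_def intro!: sum.neutral)

text \<open>Each block of length \<open>K\<close> is a coefficient times a character times a kernel.
  As \<open>x\<close> and \<open>y\<close> differ in digit \<open>l\<close>, complete blocks cancel
  and only the last one remains.\<close>

lemma psum_collapse:
  fixes l j :: nat
  defines "K \<equiv> M (Suc l)"
  assumes "s \<le> l" "l < N" "x \<in> G" "x l \<noteq> y l"
  shows "psum L a s j x = fc L a (K * (j div K)) * \<psi> (K * (j div K)) x * dir s (j mod K) x y"
proof -
  have K: "0 < K" by (simp add: K_def)
  have dvd: "M s dvd i + K * p \<longleftrightarrow> M s dvd i" for i p
    using M_dvd[of s "Suc l"] assms(2) unfolding K_def by (metis dvd_add_left_iff dvd_mult2 le_SucI)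
  have *: "(\<Sum>i<r. if M s dvd i + K * p then fc L a (i + K * p) * \<psi> (i + K * p) x else 0) =
      fc L a (K * p) * \<psi> (K * p) x * dir s r x y" if "r \<le> K" for r p
    unfolding dir_def sum_distrib_left
  proof (intro sum.cong refl)
    fix i assume "i \<in> {..<r}"
    then have i: "i < M (Suc l)" using that by (simp add: K_def)
    show "(if M s dvd i + K * p then fc L a (i + K * p) * \<psi> (i + K * p) x else 0) =
        fc L a (K * p) * \<psi> (K * p) x * (if M s dvd i then \<psi> i x * cnj (\<psi> i y) else 0)"
      using fc_add[OF _ i, of p] psi_add[OF i, of p x] assms(3) unfolding dvd by (simp add: K_def)
  qed
  have 0: "dir s K x y = 0"
    unfolding K_def using assms(2,4,5) y_G by (intro dir_vanish) (auto simp: vgroup_iff)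
  show ?thesis
    unfolding psum_def by (subst sum_lessThan_div_mod[OF K]) (simp add: * 0 K less_imp_le)
qed

text \<open>First collapse, at digit \<open>s\<close>: each partial sum is one term
  \<open>c p\<close> times a kernel of order below \<open>K\<close>. Summing over \<open>j\<close>
  turns the \<open>c p\<close> into a Fourier sum over multiples of \<open>K\<close>, which can
  collapse again.\<close>

lemma sum_psum_le:
  fixes s k :: nat
  defines "K \<equiv> M (Suc s)"
  assumes "s < N" "x \<in> G" "x s \<noteq> y s"
  shows "cmod (\<Sum>j<k. psum L a 0 j x) \<le>
    (real K)\<^sup>2 * (cmod (psum L a (Suc s) (K * (k div K)) x) + cmod (fc L a (K * (k div K))))"
proof -
  have K: "0 < K" by (simp add: K_def)
  define c where "c p = fc L a (K * p) * \<psi> (K * p) x" for p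
  have "(\<Sum>j<k. psum L a 0 j x) = (\<Sum>j<k. c (j div K) * dir 0 (j mod K) x y)"
    unfolding c_def K_def using assms by (intro sum.cong refl psum_collapse) auto
  also have "\<dots> = (\<Sum>p<k div K. c p) * (\<Sum>i<K. dir 0 i x y) + c (k div K) * (\<Sum>i<k mod K. dir 0 i x y)"
    by (subst sum_lessThan_div_mod[OF K])
      (use K mod_less_divisor[OF K, of k] in \<open>simp add: sum_distrib_right[symmetric] sum_distrib_left[symmetric]\<close>)
  finally have eq: "(\<Sum>j<k. psum L a 0 j x) =
      (\<Sum>p<k div K. c p) * (\<Sum>i<K. dir 0 i x y) + c (k div K) * (\<Sum>i<k mod K. dir 0 i x y)" .
  have psum: "(\<Sum>p<k div K. c p) = psum L a (Suc s) (K * (k div K)) x"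
  proof -
    have "(\<Sum>i<K. if K dvd i + K * p then fc L a (i + K * p) * \<psi> (i + K * p) x else 0) = c p" for p
    proof -
      have "(\<Sum>i<K. if K dvd i + K * p then fc L a (i + K * p) * \<psi> (i + K * p) x else 0) = (\<Sum>i<K. if i = 0 then c p else 0)"
        by (intro sum.cong refl) (auto simp: c_def dvd_eq_mod_eq_0)
      then show ?thesis using K by simp
    qed
    then show ?thesis
      unfolding psum_def K_def[symmetric] by (subst sum_lessThan_div_mod[OF K]) (use K in simp)
  qed
  have "cmod (psum L a (Suc s) (K * (k div K)) x * (\<Sum>i<K. dir 0 i x y) + c (k div K) * (\<Sum>i<k mod K. dir 0 i x y))
      \<le> cmod (psum L a (Suc s) (K * (k div K)) x) * (real K)\<^sup>2 + cmod (fc L a (K * (k div K))) * (real K)\<^sup>2"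
  proof -
    have D: "cmod (\<Sum>i<r. dir 0 i x y) \<le> (real K)\<^sup>2" if "r \<le> K" for r
    proof -
      have "cmod (\<Sum>i<r. dir 0 i x y) \<le> (\<Sum>i<r. real K)"
        using that cmod_dir_le[of 0 "Suc s" _ x y] by (intro sum_norm_le) (auto simp: vM_0 K_def)
      also have "\<dots> \<le> real K * real K" using that by (simp add: mult_right_mono)
      finally show ?thesis by (simp add: power2_eq_square)
    qed
    have "cmod (c p) = cmod (fc L a (K * p))" for p by (simp add: c_def norm_mult)
    then show ?thesis
      using K by (intro order_trans[OF norm_triangle_ineq] add_mono) (auto simp: norm_mult less_imp_le intro!: mult_left_mono D)
  qed
  then show ?thesis unfolding eq psum by (simp add: algebra_simps)
qed

lemma fej_le:
  fixes s k :: nat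
  defines "K \<equiv> M (Suc s)"
  assumes "s < N" "x \<in> G" "x s \<noteq> y s"
  shows "cmod (fej L a k x) \<le> (real K)\<^sup>2 / k *
    (cmod (psum L a (Suc s) (K * (Suc k div K)) x) + cmod (fc L a (K * (Suc k div K))))"
proof -
  \<comment> \<open>The sum of order 0 is empty and may be added; hence the \<open>Suc k\<close> in
    the bound.\<close>
  have "(\<Sum>j=1..k. psum L a 0 j x) = (\<Sum>j<Suc k. psum L a 0 j x)"
    by (rule sum.mono_neutral_left) (auto simp: psum_def not_le)
  then have "cmod (fej L a k x) = cmod (\<Sum>j<Suc k. psum L a 0 j x) / k"
    by (simp add: fej_def norm_divide)
  then show ?thesis
    using sum_psum_le[OF assms(2-4), of "Suc k"] unfolding K_def
    by (simp add: divide_right_mono)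
qed

text \<open>Second collapse, at digit \<open>l\<close>, of the sum over multiples of
  \<open>M (Suc s)\<close>: there remains one coefficient of size at most \<open>A / M N\<close>
  times a kernel of size at most \<open>M (Suc l) / M (Suc s)\<close>. The single coefficient in
  \<open>fej_le\<close> obeys the same bound, hence the 2.\<close>

lemma fej_le_two_diff:
  assumes "s < l" "l < N" "x \<in> G" "x s \<noteq> y s" "x l \<noteq> y l"
  shows "cmod (fej L a k x) \<le> 2 * (real B)\<^sup>2 * A * M s * M l / (real k * M N)"
proof -
  let ?K = "M (Suc s)" and ?K' = "M (Suc l)"
  define j where "j = ?K * (Suc k div ?K)"
  have "cmod (psum L a (Suc s) j x) = cmod (fc L a (?K' * (j div ?K'))) * cmod (dir (Suc s) (j mod ?K') x y)"
    using assms by (subst psum_collapse[of "Suc s" l]) (auto simp: norm_mult)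
  also have "\<dots> \<le> A / M N * (?K' / ?K)"
    using assms A_pos by (intro mult_mono fc_le cmod_dir_le) (auto simp: less_imp_le)
  finally have 1: "cmod (psum L a (Suc s) j x) \<le> A / M N * (?K' / ?K)" .
  have "cmod (fc L a j) \<le> A / M N * 1" using fc_le[of j] by simp
  also have "\<dots> \<le> A / M N * (?K' / ?K)"
    using A_pos M_mono[of "Suc s" "Suc l"] assms(1) by (intro mult_left_mono) (auto simp: le_divide_eq)
  finally have 2: "cmod (fc L a j) \<le> A / M N * (?K' / ?K)" .
  have "cmod (fej L a k x) \<le> (real ?K)\<^sup>2 / k * (cmod (psum L a (Suc s) j x) + cmod (fc L a j))"
    unfolding j_def using assms by (intro fej_le) auto
  also have "\<dots> \<le> (real ?K)\<^sup>2 / k * (2 * (A / M N * (?K' / ?K)))"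
    using 1 2 by (intro mult_left_mono) auto
  also have "\<dots> = 2 * A / (real k * M N) * (real ?K * real ?K')"
    by (simp add: power2_eq_square field_simps)
  also have "\<dots> \<le> 2 * A / (real k * M N) * ((B * real (M s)) * (B * real (M l)))"
    using A_pos by (intro mult_left_mono mult_mono M_Suc_le) auto
  finally show ?thesis by (simp add: power2_eq_square mult_ac)
qed

section \<open>Splitting the points by the digits in which they differ\<close>

definition J1 :: "nat \<Rightarrow> (nat \<Rightarrow> nat) set" where
  "J1 s = {x \<in> X L. x s \<noteq> y s \<and> (\<forall>i<N. i \<noteq> s \<longrightarrow> x i = y i)}"

definition J2 :: "nat \<Rightarrow> nat \<Rightarrow> (nat \<Rightarrow> nat) set" where
  "J2 s l = {x \<in> X L. x s \<noteq> y s \<and> x l \<noteq> y l \<and> (\<forall>i<l. i \<noteq> s \<longrightarrow> x i = y i)}"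

text \<open>Cases by the number of digits below \<open>N\<close> in which a point differs from
  \<open>y\<close>: none, one, or at least two, the least of which are \<open>s\<close> and
  \<open>l\<close>.\<close>

lemma X_cover: "X L \<subseteq> I \<union> (\<Union>s<N. J1 s) \<union> (\<Union>l<N. \<Union>s<l. J2 s l)"
proof
  fix x assume x: "x \<in> X L"
  define Df where "Df = {i. i < N \<and> x i \<noteq> y i}"
  show "x \<in> I \<union> (\<Union>s<N. J1 s) \<union> (\<Union>l<N. \<Union>s<l. J2 s l)"
  proof (cases "Df = {}")
    case True
    then show ?thesis using x by (auto simp: Df_def agree_def)
  next
    case False
    define s where "s = (LEAST i. i \<in> Df)"
    have s: "s \<in> Df" "\<And>i. i < s \<Longrightarrow> i \<notin> Df"
      using False unfolding s_def by (auto intro: LeastI dest: not_less_Least)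
    show ?thesis
    proof (cases "Df = {s}")
      case True
      then have "x \<in> J1 s" "s < N" using x by (auto simp: Df_def J1_def)
      then show ?thesis by blast
    next
      case False
      with s(1) have ne: "\<exists>i. i \<in> Df - {s}" by blast
      define l where "l = (LEAST i. i \<in> Df - {s})"
      have l: "l \<in> Df - {s}" "\<And>i. i < l \<Longrightarrow> i \<notin> Df - {s}"
        using LeastI_ex[OF ne] not_less_Least[of _ "\<lambda>i. i \<in> Df - {s}"] unfolding l_def by blast+
      have "s < l" using s(2)[of l] l(1) by (metis DiffE insertCI linorder_neqE_nat)
      moreover have "x \<in> J2 s l" "l < N" using x s(1) l by (fastforce simp: J2_def Df_def)+
      ultimately show ?thesis by blast
    qed
  qed
qed

lemma sum_cover_le:
  assumes "\<And>x. 0 \<le> (h x :: real)"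
  shows "sum h (X L) \<le> sum h I + (\<Sum>s<N. sum h (J1 s)) + (\<Sum>l<N. \<Sum>s<l. sum h (J2 s l))"
proof -
  have fin: "finite (J1 s)" "finite (J2 s l)" for s l by (simp_all add: J1_def J2_def)
  have un: "sum h (U \<union> V) \<le> sum h U + sum h V" if "finite U" "finite V" for U V
    using sum.union_inter[OF that, of h] sum_nonneg[of "U \<inter> V" h] assms by simp
  have "sum h (X L) \<le> sum h (I \<union> (\<Union>s<N. J1 s) \<union> (\<Union>l<N. \<Union>s<l. J2 s l))"
    using X_cover fin assms by (intro sum_mono2) auto
  also have "\<dots> \<le> sum h I + sum h (\<Union>s<N. J1 s) + sum h (\<Union>l<N. \<Union>s<l. J2 s l)"
    using fin by (intro order_trans[OF un] add_mono un) auto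
  also have "\<dots> \<le> sum h I + (\<Sum>s<N. sum h (J1 s)) + (\<Sum>l<N. sum h (\<Union>s<l. J2 s l))"
    using fin assms by (intro add_mono sum_UN_le) auto
  also have "\<dots> \<le> sum h I + (\<Sum>s<N. sum h (J1 s)) + (\<Sum>l<N. \<Sum>s<l. sum h (J2 s l))"
    using fin assms by (intro add_mono sum_mono sum_UN_le order_refl) auto
  finally show ?thesis .
qed

text \<open>\<open>M\<close> at least doubles, and 3 closes the induction because
  \<open>(3 + 1)^2 = 16\<close> is at most \<open>3^2 * 2 = 18\<close>.\<close>

lemma sum_sqrt_M_le: "(\<Sum>s<l. sqrt (M s)) \<le> 3 * sqrt (M l)"
proof (induction l)
  case (Suc l)
  have "4 * sqrt (M l) = sqrt (16 * M l)" by (simp add: real_sqrt_mult)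
  also have "\<dots> \<le> sqrt (9 * M (Suc l))"
    using two_M_le[of l] by (intro real_sqrt_le_mono) linarith
  finally show ?case using Suc by (simp add: real_sqrt_mult)
qed simp

lemma sum_I:
  assumes "k \<le> M L"
  shows "(\<Sum>x\<in>I. sqrt (cmod (fej L a k x))) \<le> 2 * (M L / M N) * sqrt A"
proof (rule sum_sqrt_le)
  have "(\<Sum>x\<in>I. (cmod (fej L a k x))\<^sup>2) \<le> (\<Sum>x\<in>X L. (cmod (fej L a k x))\<^sup>2)"
    by (intro sum_mono2) auto
  also have "\<dots> \<le> M L / M N * A\<^sup>2"
    using fej_L2[OF assms, of a] sum_a_le[of 2] by simp
  finally show "(\<Sum>x\<in>I. (cmod (fej L a k x))\<^sup>2) \<le> M L / M N * A\<^sup>2" .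
qed (simp_all add: A_pos card_I)

text \<open>The pointwise bound times the number of points, at most \<open>B * (M L / M l)\<close>.
  The remaining \<open>sqrt (M s) / sqrt (M l)\<close> has a bounded sum over
  \<open>s < l\<close>.\<close>

lemma sum_J2:
  assumes "s < l" "l < N" "1 \<le> k"
  shows "(\<Sum>x\<in>J2 s l. sqrt (cmod (fej L a k x))) \<le>
    2 * (real B)\<^sup>2 * (M L / M N) * sqrt A * sqrt (M N / k) * (sqrt (M s) / sqrt (M l))"
proof -
  have "real (card (J2 s l)) \<le> real (card {x \<in> X L. \<forall>i<l. i \<noteq> s \<longrightarrow> x i = y i})"
    unfolding of_nat_le_iff by (rule card_mono) (auto simp: J2_def)
  also have "\<dots> = m s * (M L / M l)"
    using assms N_le by (intro card_agree_except y_G) auto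
  also have "\<dots> \<le> B * (M L / M l)"
    using m_le by (intro mult_right_mono) auto
  finally have card: "real (card (J2 s l)) \<le> B * (M L / M l)" .
  have "sqrt (cmod (fej L a k x)) \<le> 2 * B * (sqrt A * sqrt (M s) * sqrt (M l) / (sqrt k * sqrt (M N)))"
    if "x \<in> J2 s l" for x
  proof -
    have "cmod (fej L a k x) \<le> 2 * (real B)\<^sup>2 * A * M s * M l / (real k * M N)"
      using that assms X_G by (intro fej_le_two_diff) (auto simp: J2_def)
    also have "\<dots> = 2 * ((real B)\<^sup>2 * A * M s * M l / (real k * M N))" by simp
    \<comment> \<open>Enlarged from 2 to 4 to get a perfect square under the root.\<close>
    also have "\<dots> \<le> 4 * ((real B)\<^sup>2 * A * M s * M l / (real k * M N))"
      using A_pos by (intro mult_right_mono) auto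
    also have "\<dots> = (2 * real B)\<^sup>2 * A * M s * M l / (real k * M N)" by (simp add: power_mult_distrib)
    finally have "sqrt (cmod (fej L a k x)) \<le> sqrt ((2 * real B)\<^sup>2 * A * M s * M l / (real k * M N))"
      by (rule real_sqrt_le_mono)
    then show ?thesis by (simp add: real_sqrt_mult real_sqrt_divide)
  qed
  then have "(\<Sum>x\<in>J2 s l. sqrt (cmod (fej L a k x))) \<le>
      real (card (J2 s l)) * (2 * B * (sqrt A * sqrt (M s) * sqrt (M l) / (sqrt k * sqrt (M N))))"
    by (rule sum_bounded_above)
  also have "\<dots> \<le> B * (M L / M l) * (2 * B * (sqrt A * sqrt (M s) * sqrt (M l) / (sqrt k * sqrt (M N))))"
    using card A_pos by (intro mult_right_mono) auto
  also have "\<dots> = 2 * (real B)\<^sup>2 * (M L / M N) * sqrt A * sqrt (M N / k) * (sqrt (M s) / sqrt (M l))"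
  proof -
    define p q where "p = sqrt (M l)" and "q = sqrt (M N)"
    have pq: "real (M l) = p * p" "real (M N) = q * q" "0 < p" "0 < q"
      by (simp_all add: p_def q_def)
    have "M L / M l * (p / q) = M L / M N * (q / p)"
      unfolding pq using pq(3,4) by (simp add: field_simps)
    then have "2 * (real B)\<^sup>2 * sqrt A * sqrt (M s) / sqrt k * (M L / M l * (p / q)) =
        2 * (real B)\<^sup>2 * sqrt A * sqrt (M s) / sqrt k * (M L / M N * (q / p))"
      by simp
    then show ?thesis
      unfolding real_sqrt_divide p_def[symmetric] q_def[symmetric] power2_eq_square by (simp add: mult_ac)
  qed
  finally show ?thesis .
qed

text \<open>All coefficients in a block of length \<open>M l\<close> have the modulus of the first
  one, so the first ones carry the share \<open>1 / M l\<close> of an energy that Parseval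
  bounds.\<close>

lemma fc_gain:
  assumes "l \<le> N" "M l * q \<le> M L"
  shows "M l * (\<Sum>i | i < M l * q \<and> M l dvd i. (cmod (fc L a i))\<^sup>2) \<le> A\<^sup>2 / M N"
proof -
  let ?K = "M l"
  have "(\<Sum>i | i < ?K * q \<and> ?K dvd i. (cmod (fc L a i))\<^sup>2) = (\<Sum>p<q. (cmod (fc L a (?K * p)))\<^sup>2)"
    by (rule sum.reindex_bij_witness[of _ "\<lambda>p. ?K * p" "\<lambda>i. i div ?K"]) (auto simp: less_mult_imp_div_less mult.commute)
  then have "?K * (\<Sum>i | i < ?K * q \<and> ?K dvd i. (cmod (fc L a i))\<^sup>2) = (\<Sum>p<q. \<Sum>i<?K. (cmod (fc L a (?K * p)))\<^sup>2)"
    by (simp add: sum_distrib_left)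
  also have "\<dots> = (\<Sum>p<q. \<Sum>i<?K. (cmod (fc L a (i + ?K * p)))\<^sup>2)"
    using assms(1) by (intro sum.cong refl) (simp add: fc_add norm_mult)
  also have "\<dots> = (\<Sum>i<?K * q. (cmod (fc L a i))\<^sup>2)"
    by (subst sum_lessThan_div_mod[OF M_gr0[of l], of _ "?K * q"]) simp
  also have "\<dots> \<le> (\<Sum>i<M L. (cmod (fc L a i))\<^sup>2)"
    using assms(2) by (intro sum_mono2) auto
  also have "\<dots> \<le> A\<^sup>2 / M N"
    unfolding parseval_fc using sum_a_le[of 2] by (simp add: field_simps)
  finally show ?thesis .
qed

text \<open>The sum over multiples of \<open>M (Suc s)\<close> has effective height
  \<open>A / M s\<close> instead of \<open>A\<close>: Parseval on the cylinder of level
  \<open>s\<close> around \<open>y\<close> is combined with \<open>fc_gain\<close>. This offsets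
  part of the factor \<open>(M (Suc s))^2 / k\<close> from \<open>fej_le\<close>.\<close>

lemma sum_J1:
  assumes "s < N" "M N \<le> k" "k < M L"
  shows "(\<Sum>x\<in>J1 s. sqrt (cmod (fej L a k x))) \<le> 3 * (real B)\<^sup>2 * (M L / M N) * sqrt A * sqrt (M s) / sqrt k"
proof -
  let ?K = "M (Suc s)"
  define j where "j = ?K * (Suc k div ?K)"
  \<comment> \<open>Here \<open>k < M L\<close> enters as \<open>Suc k \<le> M L\<close>.\<close>
  have j: "j \<le> M L" using assms(3) unfolding j_def by (metis Suc_leI le_trans times_div_less_eq_dividend)
  define c where "c = B * (M L / M N)"
  have c0: "0 \<le> c" by (simp add: c_def)
  have "real (card (J1 s)) \<le> real (card {x \<in> X L. \<forall>i<N. i \<noteq> s \<longrightarrow> x i = y i})"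
    unfolding of_nat_le_iff by (rule card_mono) (auto simp: J1_def)
  also have "\<dots> = m s * (M L / M N)"
    using assms N_le by (intro card_agree_except y_G) auto
  also have "\<dots> \<le> c"
    unfolding c_def using m_le by (intro mult_right_mono) auto
  finally have card: "real (card (J1 s)) \<le> c" .
  have As: "0 < A / M s" using A_pos by simp
  have 1: "(\<Sum>x\<in>J1 s. sqrt (cmod (psum L a (Suc s) j x))) \<le> 2 * c * sqrt (A / M s)"
  proof (rule sum_sqrt_le[OF As card])
    let ?D = "{i. i < j \<and> ?K dvd i}"
    have eq: "psum L a (Suc s) j x = (\<Sum>i\<in>?D. fc L a i * \<psi> i x)" for x
      unfolding psum_def by (simp add: sum.If_cases Int_def)
    have "(\<Sum>x\<in>J1 s. (cmod (psum L a (Suc s) j x))\<^sup>2) \<le> (\<Sum>x | x \<in> X L \<and> agree s x y. (cmod (psum L a (Suc s) j x))\<^sup>2)"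
      using assms(1) by (intro sum_mono2) (auto simp: J1_def agree_def)
    also have "\<dots> = M L / M s * (\<Sum>i\<in>?D. (cmod (fc L a i))\<^sup>2)"
      unfolding eq using assms(1) N_le j M_dvd[of s "Suc s"]
      by (intro parseval_cylinder[OF y_G]) (auto intro: dvd_trans)
    also have "\<dots> \<le> M L / M s * (A\<^sup>2 / M N / ?K)"
    proof (intro mult_left_mono)
      have "?K * (\<Sum>i\<in>?D. (cmod (fc L a i))\<^sup>2) \<le> A\<^sup>2 / M N"
        using fc_gain[of "Suc s" "Suc k div ?K"] assms(1) j unfolding j_def by simp
      then show "(\<Sum>i\<in>?D. (cmod (fc L a i))\<^sup>2) \<le> A\<^sup>2 / M N / ?K"
        by (simp add: le_divide_eq mult.commute)
    qed simp
    also have "\<dots> = 1 * (M L / M N) * (A\<^sup>2 / (M s * ?K))" by simp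
    \<comment> \<open>The factor 1 is raised to \<open>B\<close> to match the bound \<open>c\<close>
      on the cardinality.\<close>
    also have "\<dots> \<le> B * (M L / M N) * (A\<^sup>2 / (M s * M s))"
      using B_ge_1 M_mono[of s "Suc s"]
      by (intro mult_mono divide_left_mono mult_left_mono) auto
    finally show "(\<Sum>x\<in>J1 s. (cmod (psum L a (Suc s) j x))\<^sup>2) \<le> c * (A / M s)\<^sup>2"
      by (simp add: c_def power2_eq_square)
  qed simp
  have 2: "(\<Sum>x\<in>J1 s. sqrt (cmod (fc L a j))) \<le> c * sqrt (A / M s)"
  proof -
    have "cmod (fc L a j) \<le> A / M s"
      using fc_le[of j] A_pos M_mono[of s N] assms(1)
      by (intro order_trans[OF fc_le]) (auto intro!: divide_left_mono)
    then have "(\<Sum>x\<in>J1 s. sqrt (cmod (fc L a j))) \<le> real (card (J1 s)) * sqrt (A / M s)"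
      by (intro sum_bounded_above real_sqrt_le_mono)
    also have "\<dots> \<le> c * sqrt (A / M s)"
      using card A_pos by (intro mult_right_mono) auto
    finally show ?thesis .
  qed
  have "sqrt (cmod (fej L a k x)) \<le> ?K / sqrt k * (sqrt (cmod (psum L a (Suc s) j x)) + sqrt (cmod (fc L a j)))"
    if "x \<in> J1 s" for x
  proof -
    let ?u = "cmod (psum L a (Suc s) j x)" and ?v = "cmod (fc L a j)"
    have "cmod (fej L a k x) \<le> (real ?K)\<^sup>2 / k * (?u + ?v)"
      unfolding j_def using that assms X_G by (intro fej_le) (auto simp: J1_def)
    then have "sqrt (cmod (fej L a k x)) \<le> sqrt ((real ?K)\<^sup>2 / k * (?u + ?v))" by (rule real_sqrt_le_mono)
    also have "\<dots> = ?K / sqrt k * sqrt (?u + ?v)" by (simp add: real_sqrt_mult real_sqrt_divide)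
    also have "\<dots> \<le> ?K / sqrt k * (sqrt ?u + sqrt ?v)"
      by (intro mult_left_mono sqrt_add_le_add_sqrt) auto
    finally show ?thesis .
  qed
  then have "(\<Sum>x\<in>J1 s. sqrt (cmod (fej L a k x))) \<le>
      (\<Sum>x\<in>J1 s. ?K / sqrt k * (sqrt (cmod (psum L a (Suc s) j x)) + sqrt (cmod (fc L a j))))"
    by (rule sum_mono)
  also have "\<dots> = ?K / sqrt k * ((\<Sum>x\<in>J1 s. sqrt (cmod (psum L a (Suc s) j x))) + (\<Sum>x\<in>J1 s. sqrt (cmod (fc L a j))))"
    by (simp only: sum_distrib_left[symmetric] sum.distrib)
  also have "\<dots> \<le> ?K / sqrt k * (2 * c * sqrt (A / M s) + c * sqrt (A / M s))"
    using 1 2 by (intro mult_left_mono add_mono) auto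
  also have "\<dots> = ?K / sqrt k * (3 * c * sqrt (A / M s))" by simp
  also have "\<dots> \<le> B * real (M s) / sqrt k * (3 * c * sqrt (A / M s))"
    using c0 A_pos by (intro mult_right_mono divide_right_mono M_Suc_le) auto
  also have "\<dots> = 3 * (real B)\<^sup>2 * (M L / M N) * sqrt A * sqrt (M s) / sqrt k"
  proof -
    have "real (M s) * sqrt (A / M s) = sqrt A * (real (M s) / sqrt (M s))"
      by (simp add: real_sqrt_divide)
    also have "real (M s) / sqrt (M s) = sqrt (M s)" by (simp add: real_div_sqrt)
    finally have *: "real (M s) * sqrt (A / M s) = sqrt A * sqrt (M s)" .
    have "B * real (M s) / sqrt k * (3 * c * sqrt (A / M s)) = B / sqrt k * 3 * c * (sqrt A * sqrt (M s))"
      unfolding *[symmetric] by simp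
    also have "\<dots> = 3 * (real B)\<^sup>2 * (M L / M N) * sqrt A * sqrt (M s) / sqrt k"
      by (simp add: c_def power2_eq_square mult_ac)
    finally show ?thesis .
  qed
  finally show ?thesis .
qed

text \<open>The sums over \<open>J1 s\<close> add up geometrically to a bounded factor, as
  \<open>M N \<le> k\<close>. For \<open>J2 s l\<close> the sum over \<open>s\<close> is bounded for
  each \<open>l\<close>, and the \<open>N\<close> values of \<open>l\<close> produce the factor
  \<open>N\<close>.\<close>

lemma sum_sqrt_fej_le:
  assumes "M N \<le> k" "k < M L"
  shows "(\<Sum>x\<in>X L. sqrt (cmod (fej L a k x))) \<le>
    M L / M N * sqrt A * (2 + 9 * (real B)\<^sup>2 + 6 * (real B)\<^sup>2 * N * sqrt (M N) / sqrt k)"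
proof -
  define R where "R = M L / M N * sqrt A"
  have R: "0 \<le> R" using A_pos by (simp add: R_def)
  have k: "1 \<le> k" using assms(1) M_gr0[of N] by linarith
  let ?h = "\<lambda>x. sqrt (cmod (fej L a k x))"
  have 1: "sum ?h I \<le> R * 2" using sum_I[of k] assms(2) by (simp add: R_def mult_ac)
  have "(\<Sum>s<N. sum ?h (J1 s)) \<le> (\<Sum>s<N. 3 * (real B)\<^sup>2 * R / sqrt k * sqrt (M s))"
    using sum_J1[OF _ assms] by (intro sum_mono) (simp add: R_def mult_ac)
  also have "\<dots> = 3 * (real B)\<^sup>2 * R / sqrt k * (\<Sum>s<N. sqrt (M s))"
    by (simp add: sum_distrib_left)
  also have "\<dots> \<le> 3 * (real B)\<^sup>2 * R / sqrt k * (3 * sqrt (M N))"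
    using R by (intro mult_left_mono sum_sqrt_M_le) auto
  also have "\<dots> = 9 * (real B)\<^sup>2 * R * (sqrt (M N) / sqrt k)" by simp
  also have "\<dots> \<le> 9 * (real B)\<^sup>2 * R * 1"
    using assms(1) R k by (intro mult_left_mono) (auto simp: divide_le_eq)
  finally have 2: "(\<Sum>s<N. sum ?h (J1 s)) \<le> R * (9 * (real B)\<^sup>2)" by (simp add: mult_ac)
  have "(\<Sum>l<N. \<Sum>s<l. sum ?h (J2 s l)) \<le> (\<Sum>l<N. \<Sum>s<l. 2 * (real B)\<^sup>2 * R * (sqrt (M N) / sqrt k) / sqrt (M l) * sqrt (M s))"
    using sum_J2[OF _ _ k] by (intro sum_mono) (simp add: R_def real_sqrt_divide mult_ac)
  also have "\<dots> = (\<Sum>l<N. 2 * (real B)\<^sup>2 * R * (sqrt (M N) / sqrt k) / sqrt (M l) * (\<Sum>s<l. sqrt (M s)))"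
    by (simp add: sum_distrib_left)
  also have "\<dots> \<le> (\<Sum>l<N. 2 * (real B)\<^sup>2 * R * (sqrt (M N) / sqrt k) / sqrt (M l) * (3 * sqrt (M l)))"
    using R by (intro sum_mono mult_left_mono sum_sqrt_M_le) auto
  also have "\<dots> = R * (6 * (real B)\<^sup>2 * N * sqrt (M N) / sqrt k)"
    by simp
  finally have 3: "(\<Sum>l<N. \<Sum>s<l. sum ?h (J2 s l)) \<le> R * (6 * (real B)\<^sup>2 * N * sqrt (M N) / sqrt k)" .
  have "sum ?h (X L) \<le> sum ?h I + (\<Sum>s<N. sum ?h (J1 s)) + (\<Sum>l<N. \<Sum>s<l. sum ?h (J2 s l))"
    by (rule sum_cover_le) simp
  with 1 2 3 have "sum ?h (X L) \<le> R * (2 + 9 * (real B)\<^sup>2 + 6 * (real B)\<^sup>2 * N * sqrt (M N) / sqrt k)"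
    unfolding distrib_left by linarith
  then show ?thesis by (simp only: R_def)
qed

text \<open>The constant collects \<open>3 * (2 + 9 * b)\<close> from the harmonic sum, where
  \<open>1 + ln n \<le> 3 * ln n\<close>, and \<open>18 * b * N \<le> 36 * b * ln n\<close> from the
  part with factor \<open>N\<close>.\<close>

lemma atom_estimate:
  assumes n: "2 \<le> n" "n < M L"
  shows "(\<Sum>k=1..n. (\<Sum>x\<in>X L. sqrt (cmod (fej L a k x))) / k) \<le> (6 + 63 * (real B)\<^sup>2) * ln n * (M L / M N * sqrt A)"
proof -
  define R where "R = M L / M N * sqrt A"
  have R: "0 \<le> R" using A_pos by (simp add: R_def)
  define h where "h k = (\<Sum>x\<in>X L. sqrt (cmod (fej L a k x))) / k" for k
  define b where "b = (real B)\<^sup>2"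
  have b: "0 \<le> b" by (simp add: b_def)
  have ln: "1 / 2 \<le> ln (real n)" using half_le_ln n by simp
  have "(\<Sum>k=1..n. h k) \<le> (6 + 63 * b) * ln n * R"
  proof (cases "M N \<le> n")
    case False
    have "h k = 0" if "k \<in> {1..n}" for k
    proof -
      \<comment> \<open>\<open>M 0 = 1\<close> does not exceed \<open>n\<close>, so \<open>N\<close>
        is positive and the atom has mean zero.\<close>
      have "N \<noteq> 0" using False n by (auto simp: vM_0 intro!: Nat.gr0I)
      then show ?thesis using fej_zero[of k] that False by (simp add: h_def)
    qed
    then show ?thesis using ln R b by simp
  next
    case True
    have "(\<Sum>k=1..n. h k) = (\<Sum>k=M N..n. h k)"
    proof (rule sum.mono_neutral_right)
      show "\<forall>k\<in>{1..n} - {M N..n}. h k = 0"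
      proof
        fix k assume k: "k \<in> {1..n} - {M N..n}"
        then have "N \<noteq> 0" "k \<le> M N" by (auto simp: vM_0 intro!: Nat.gr0I)
        then show "h k = 0" by (simp add: h_def fej_zero)
      qed
    qed (use M_gr0[of N] in \<open>auto simp: Suc_le_eq intro: less_le_trans\<close>)
    also have "\<dots> \<le> (\<Sum>k=M N..n. R * ((2 + 9 * b) * (1 / k) + 6 * b * N * sqrt (M N) * (1 / (real k * sqrt k))))"
    proof (rule sum_mono)
      fix k assume k: "k \<in> {M N..n}"
      have "h k \<le> R * (2 + 9 * b + 6 * b * N * sqrt (M N) / sqrt k) / k"
        unfolding h_def R_def b_def using k n by (intro divide_right_mono sum_sqrt_fej_le) auto
      also have "\<dots> = R * ((2 + 9 * b) * (1 / k) + 6 * b * N * sqrt (M N) * (1 / (real k * sqrt k)))"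
        by (simp add: add_divide_distrib distrib_left mult_ac)
      finally show "h k \<le> R * ((2 + 9 * b) * (1 / k) + 6 * b * N * sqrt (M N) * (1 / (real k * sqrt k)))" .
    qed
    also have "\<dots> = R * ((2 + 9 * b) * (\<Sum>k=M N..n. 1 / k) + 6 * b * N * sqrt (M N) * (\<Sum>k=M N..n. 1 / (real k * sqrt k)))"
      by (simp only: sum_distrib_left[symmetric] sum.distrib)
    also have "\<dots> \<le> R * ((2 + 9 * b) * (3 * ln n) + 6 * b * N * sqrt (M N) * (3 / sqrt (M N)))"
    proof (intro mult_left_mono add_mono)
      have "(\<Sum>k=M N..n. 1 / real k) \<le> (\<Sum>k=1..n. 1 / real k)"
        by (intro sum_mono2) (use M_ge_1 in auto)
      also have "\<dots> \<le> 1 + ln n" using n by (intro harmonic_sum_le) simp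
      finally show "(\<Sum>k=M N..n. 1 / real k) \<le> 3 * ln n" using ln by linarith
      have "(\<Sum>k=M N..n. 1 / (real k * sqrt k)) \<le> 3 / sqrt (M N) - 2 / sqrt n"
        using True by (intro sum_inverse_sqrt_tail M_ge_1)
      also have "\<dots> \<le> 3 / sqrt (M N)" by simp
      finally show "(\<Sum>k=M N..n. 1 / (real k * sqrt k)) \<le> 3 / sqrt (M N)" .
    qed (use R b in auto)
    also have "\<dots> = R * ((6 + 27 * b) * ln n + 18 * b * N)"
      by (simp add: algebra_simps)
    also have "\<dots> \<le> R * ((6 + 27 * b) * ln n + 18 * b * (2 * ln n))"
    proof (intro mult_left_mono add_mono order_refl)
      have "2 ^ N \<le> n" using two_power_le_M[of N] True by simp
      then have "real (2 ^ N) \<le> real n" by (simp only: of_nat_le_iff)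
      then have "ln (2 ^ N) \<le> ln (real n)" using n by simp
      then have "N * ln 2 \<le> ln (real n)" by (simp add: ln_realpow)
      moreover have "N * (1 / 2) \<le> N * ln (2::real)"
        using ln2_ge_two_thirds by (intro mult_left_mono) auto
      ultimately show "real N \<le> 2 * ln n" by linarith
    qed (use R b in auto)
    also have "\<dots> = (6 + 63 * b) * ln n * R" by (simp add: algebra_simps)
    finally show ?thesis .
  qed
  then show ?thesis by (simp only: h_def R_def b_def)
qed

end

section \<open>Atomic decomposition of a martingale of finite level\<close>

context vilenkin
begin

text \<open>For \<open>g\<close> of level \<open>L\<close> and \<open>n \<le> M L\<close>, this is
  \<open>M L\<close> times the sum over \<open>k\<close>, weighted by \<open>1 / k\<close>, of the
  integrals of the square roots of the moduli of the Fejer means.\<close>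

definition Phi :: "nat \<Rightarrow> nat \<Rightarrow> ((nat \<Rightarrow> nat) \<Rightarrow> complex) \<Rightarrow> real" where
  "Phi L n g = (\<Sum>k=1..n. (\<Sum>x\<in>X L. sqrt (cmod (fej L g k x))) / k)"

lemma fc_plus: "fc L (\<lambda>x. g x + h x) i = fc L g i + fc L h i"
  by (simp add: fc_def distrib_right sum.distrib add_divide_distrib)

lemma fej_plus: "fej L (\<lambda>x. g x + h x) k x = fej L g k x + fej L h k x"
proof -
  have "psum L (\<lambda>x. g x + h x) 0 j x = psum L g 0 j x + psum L h 0 j x" for j
    unfolding psum_def sum.distrib[symmetric] by (intro sum.cong refl) (simp add: fc_plus distrib_right)
  then show ?thesis by (simp add: fej_def sum.distrib add_divide_distrib)
qed

lemma Phi_plus_le: "Phi L n (\<lambda>x. g x + h x) \<le> Phi L n g + Phi L n h"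
  unfolding Phi_def sum.distrib[symmetric] add_divide_distrib[symmetric] fej_plus
proof (intro sum_mono divide_right_mono)
  fix k x
  have "sqrt (cmod (fej L g k x + fej L h k x)) \<le> sqrt (cmod (fej L g k x) + cmod (fej L h k x))"
    by (intro real_sqrt_le_mono norm_triangle_ineq)
  also have "\<dots> \<le> sqrt (cmod (fej L g k x)) + sqrt (cmod (fej L h k x))"
    by (rule sqrt_add_le_add_sqrt) auto
  finally show "sqrt (cmod (fej L g k x + fej L h k x)) \<le> sqrt (cmod (fej L g k x)) + sqrt (cmod (fej L h k x))" .
qed simp

lemma Phi_cong:
  assumes "\<And>x. x \<in> X L \<Longrightarrow> g x = h x"
  shows "Phi L n g = Phi L n h"
proof -
  have eq: "fc L g = fc L h" using assms by (simp add: fc_def fun_eq_iff)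
  show ?thesis unfolding Phi_def fej_def psum_def eq ..
qed

lemma Phi_zero: "Phi L n (\<lambda>_. 0) = 0"
  by (simp add: Phi_def fej_def psum_def fc_def cong: if_cong)

lemma Phi_sum_le:
  assumes "finite S"
  shows "Phi L n (\<lambda>x. \<Sum>i\<in>S. g i x) \<le> (\<Sum>i\<in>S. Phi L n (g i))"
  using assms
proof (induction S rule: finite_induct)
  case (insert i S)
  then show ?case
    using Phi_plus_le[of L n "g i" "\<lambda>x. \<Sum>i\<in>S. g i x"] by simp
qed (simp add: Phi_zero)

text \<open>One representative agrees with \<open>x\<close>: the cardinality formula with equal
  levels gives 1. Used to split functions over the cylinders of level \<open>n\<close>.\<close>

lemma sum_X_agree:
  fixes c :: "'c::real_normed_vector"
  assumes "x \<in> G"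
  shows "(\<Sum>r\<in>X n. if agree n x r then c else 0) = c"
proof -
  have eq: "agree n x r = agree n r x" for r using agree_sym by blast
  have "real (card {r \<in> X n. agree n r x}) = 1"
    using card_agree[OF assms, of n n] by simp
  then have "card {r \<in> X n. agree n r x} = 1" by linarith
  then obtain r where "{r \<in> X n. agree n r x} = {r}" by (auto simp: card_1_singleton_iff)
  then show ?thesis
    unfolding eq by (simp add: sum.inter_filter[symmetric])
qed

end

text \<open>Only the levels up to \<open>L\<close> matter, so that integrals become averages over the
  representatives \<open>X L\<close> of the cylinders of level \<open>L\<close>.\<close>

locale vilenkin_martingale = vilenkin_bounded +
  fixes L :: nat and f :: "nat \<Rightarrow> (nat \<Rightarrow> nat) \<Rightarrow> complex"
  assumes L_pos: "0 < L"
    and f_cong: "x \<in> G \<Longrightarrow> y \<in> G \<Longrightarrow> agree n x y \<Longrightarrow> f n x = f n y"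
    and f_avg: "n < L \<Longrightarrow> y \<in> G \<Longrightarrow>
      (\<Sum>x | x \<in> X L \<and> agree n x y. f (Suc n) x) = of_nat (M L) / of_nat (M n) * f n y"
begin

text \<open>Martingale differences are orthogonal to functions of the first \<open>k\<close> digits:
  replacing \<open>f k\<close> by its cylinder average and exchanging the sums moves the averaging
  onto \<open>h\<close>, which is constant there.\<close>

lemma sum_mart_diff:
  assumes k: "k < L" and h: "\<And>x y. x \<in> X L \<Longrightarrow> y \<in> X L \<Longrightarrow> agree k x y \<Longrightarrow> h x = h y"
  shows "(\<Sum>x\<in>X L. h x * (f (Suc k) x - f k x)) = 0"
proof -
  let ?c = "of_nat (M k) / of_nat (M L) :: complex"
  have "(\<Sum>x\<in>X L. h x * f k x) = (\<Sum>x\<in>X L. \<Sum>y\<in>X L. if agree k y x then ?c * (h x * f (Suc k) y) else 0)"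
  proof (intro sum.cong refl)
    fix x assume x: "x \<in> X L"
    have "f k x = ?c * (\<Sum>y | y \<in> X L \<and> agree k y x. f (Suc k) y)"
      using f_avg[OF k X_G[OF x]] by simp
    then have "h x * f k x = (\<Sum>y | y \<in> X L \<and> agree k y x. ?c * (h x * f (Suc k) y))"
      by (simp add: sum_distrib_left mult_ac)
    then show "h x * f k x = (\<Sum>y\<in>X L. if agree k y x then ?c * (h x * f (Suc k) y) else 0)"
      by (simp only: sum.inter_filter[OF finite_X, symmetric])
  qed
  also have "\<dots> = (\<Sum>y\<in>X L. \<Sum>x\<in>X L. if agree k x y then ?c * (h y * f (Suc k) y) else 0)"
  proof (subst sum.swap, intro sum.cong refl)
    fix y x assume xy: "y \<in> X L" "x \<in> X L"
    have "agree k y x \<longleftrightarrow> agree k x y" by (metis agree_sym)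
    then show "(if agree k y x then ?c * (h x * f (Suc k) y) else 0) = (if agree k x y then ?c * (h y * f (Suc k) y) else 0)"
      using h[OF xy(2,1)] by simp
  qed
  also have "\<dots> = (\<Sum>y\<in>X L. h y * f (Suc k) y)"
  proof (intro sum.cong refl)
    fix y assume y: "y \<in> X L"
    have "real (card {x \<in> X L. agree k x y}) = M L / M k"
      using card_agree[OF X_G[OF y], of k L] k by simp
    then have "complex_of_real (real (card {x \<in> X L. agree k x y})) = complex_of_real (M L / M k)"
      by (rule arg_cong)
    then have "(of_nat (card {x \<in> X L. agree k x y}) :: complex) = of_nat (M L) / of_nat (M k)"
      by simp
    then show "(\<Sum>x\<in>X L. if agree k x y then ?c * (h y * f (Suc k) y) else 0) = h y * f (Suc k) y"
      by (simp add: sum.inter_filter[symmetric])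
  qed
  finally show ?thesis by (simp add: right_diff_distrib sum_subtractf)
qed

text \<open>Looking one level ahead makes the stopping rule predictable: before stopping the martingale
  is bounded by \<open>t\<close>. As \<open>m\<close> is bounded, this enlarges the stopping set by at most a factor \<open>B\<close>.\<close>

definition bad :: "real \<Rightarrow> nat \<Rightarrow> (nat \<Rightarrow> nat) \<Rightarrow> bool" where
  "bad t n x \<longleftrightarrow> t < cmod (f 0 x) \<or> (\<exists>y\<in>X L. agree n y x \<and> t < cmod (f (Suc n) y))"

definition good :: "real \<Rightarrow> nat \<Rightarrow> (nat \<Rightarrow> nat) \<Rightarrow> bool" where
  "good t n x \<longleftrightarrow> (\<forall>i\<le>n. \<not> bad t i x)"

text \<open>The event that the stopping time equals \<open>n\<close>.\<close>

definition fail :: "real \<Rightarrow> nat \<Rightarrow> (nat \<Rightarrow> nat) \<Rightarrow> bool" where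
  "fail t n x \<longleftrightarrow> bad t n x \<and> (\<forall>i<n. \<not> bad t i x)"

text \<open>The stopped martingale, with an initial value above \<open>t\<close> replaced by 0. As
  \<open>good t k\<close> depends on the first \<open>k\<close> digits only, it is a martingale
  transform.\<close>

definition stop :: "real \<Rightarrow> nat \<Rightarrow> (nat \<Rightarrow> nat) \<Rightarrow> complex" where
  "stop t K x = (if cmod (f 0 x) \<le> t then f 0 x else 0) +
     (\<Sum>k<K. if good t k x then f (Suc k) x - f k x else 0)"

section \<open>Properties of the stopping rule\<close>

lemma f0_eq: "x \<in> G \<Longrightarrow> y \<in> G \<Longrightarrow> f 0 x = f 0 y"
  by (rule f_cong) auto

lemma bad_cong:
  assumes "x \<in> G" "y \<in> G" "agree n x y" "i \<le> n"
  shows "bad t i x = bad t i y"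
proof -
  have "agree i x y" using assms agree_le by blast
  then have "agree i z x \<longleftrightarrow> agree i z y" for z
    using agree_sym agree_trans by blast
  then show ?thesis unfolding bad_def using f0_eq[OF assms(1,2)] by simp
qed

lemma good_cong: "x \<in> G \<Longrightarrow> y \<in> G \<Longrightarrow> agree n x y \<Longrightarrow> good t n x = good t n y"
  unfolding good_def using bad_cong by blast

lemma fail_cong: "x \<in> G \<Longrightarrow> y \<in> G \<Longrightarrow> agree n x y \<Longrightarrow> fail t n x = fail t n y"
  unfolding fail_def using bad_cong[of x y n] by auto

lemma bad_mono: "t \<le> t' \<Longrightarrow> bad t' n x \<Longrightarrow> bad t n x"
  unfolding bad_def by fastforce

lemma fail_unique: "fail t i x \<Longrightarrow> fail t j x \<Longrightarrow> i = j"
  unfolding fail_def by (metis linorder_neqE_nat)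

text \<open>Before stopping the value is that of \<open>f\<close>, and absence of badness at level
  \<open>K\<close> bounds \<open>f (Suc K)\<close> by \<open>t\<close>; after stopping the value no
  longer changes.\<close>

lemma stop_invariant:
  assumes "0 \<le> t" "x \<in> X L"
  shows "cmod (stop t K x) \<le> t \<and> (cmod (f 0 x) \<le> t \<and> (\<forall>i<K. \<not> bad t i x) \<longrightarrow> stop t K x = f K x)"
proof (induction K)
  case 0
  then show ?case using assms by (simp add: stop_def)
next
  case (Suc K)
  have step: "stop t (Suc K) x = stop t K x + (if good t K x then f (Suc K) x - f K x else 0)"
    by (simp add: stop_def)
  show ?case
  proof (cases "good t K x")
    case True
    then have nb: "\<not> bad t i x" if "i \<le> K" for i using that by (simp add: good_def)
    then have "cmod (f 0 x) \<le> t" "cmod (f (Suc K) x) \<le> t"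
      using nb[of K] assms(2) by (auto simp: bad_def not_less)
    then show ?thesis using Suc nb True by (simp add: step)
  next
    case False
    then have "\<not> (\<forall>i<Suc K. \<not> bad t i x)" by (auto simp: good_def less_Suc_eq_le)
    moreover have "stop t (Suc K) x = stop t K x" using False by (simp add: step)
    ultimately show ?thesis using Suc by metis
  qed
qed

text \<open>Where height \<open>t\<close> never stops, both stopped martingales equal
  \<open>f L\<close> and the difference vanishes. Elsewhere there is one stopping level and one
  representative on it.\<close>

lemma stop_diff_sum:
  assumes "0 \<le> t" "t \<le> t'" "x \<in> X L"
  shows "stop t' L x - stop t L x =
    (\<Sum>n<L. \<Sum>r\<in>X n. if agree n x r \<and> fail t n r then stop t' L x - stop t L x else 0)"
proof -
  let ?d = "stop t' L x - stop t L x"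
  have xG: "x \<in> G" using assms(3) by (rule X_G)
  have "(\<Sum>r\<in>X n. if agree n x r \<and> fail t n r then ?d else 0) = (if fail t n x then ?d else 0)" for n
  proof -
    have "(\<Sum>r\<in>X n. if agree n x r \<and> fail t n r then ?d else 0) = (\<Sum>r\<in>X n. if agree n x r then (if fail t n x then ?d else 0) else 0)"
      using fail_cong[OF xG X_G] by (intro sum.cong) auto
    then show ?thesis by (simp only: sum_X_agree[OF xG])
  qed
  then have eq: "(\<Sum>n<L. \<Sum>r\<in>X n. if agree n x r \<and> fail t n r then ?d else 0) = (\<Sum>n<L. if fail t n x then ?d else 0)"
    by simp
  show ?thesis
  proof (cases "\<exists>n<L. fail t n x")
    case True
    then obtain n where n: "n < L" "fail t n x" by blast
    then have "(\<Sum>n<L. if fail t n x then ?d else 0) = (\<Sum>i<L. if i = n then ?d else 0)"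
      using fail_unique by (intro sum.cong refl if_cong) blast+
    then show ?thesis unfolding eq using n(1) by simp
  next
    case False
    have nb: "\<not> bad t n x" if "n < L" for n
      using that
    proof (induction n rule: less_induct)
      case (less n)
      then show ?case using False by (auto simp: fail_def)
    qed
    then have nb': "\<not> bad t' n x" if "n < L" for n
      using that bad_mono[OF assms(2)] by blast
    \<comment> \<open>The bound on \<open>f 0\<close> comes from level 0, which is below
      \<open>L\<close>.\<close>
    have "cmod (f 0 x) \<le> t" using nb[OF L_pos] by (auto simp: bad_def)
    then have "stop t L x = f L x" "stop t' L x = f L x"
      using stop_invariant[of t x L] stop_invariant[of t' x L] assms nb nb' by auto
    then show ?thesis by (simp cong: if_cong)
  qed
qed

definition piece :: "real \<Rightarrow> real \<Rightarrow> nat \<Rightarrow> (nat \<Rightarrow> nat) \<Rightarrow> (nat \<Rightarrow> nat) \<Rightarrow> complex" where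
  "piece t t' n r x = (if agree n x r \<and> fail t n r then stop t' L x - stop t L x else 0)"

text \<open>On the cylinder both transforms keep the same increments below \<open>n\<close>; from
  \<open>n\<close> on only that of height \<open>t'\<close> keeps any. This leaves differences
  \<open>f (Suc k) - f k\<close> with weights depending on the first \<open>k\<close> digits, each
  of mean zero.\<close>

lemma sum_piece_zero:
  assumes "t \<le> t'" "r \<in> G" "n \<noteq> 0"
  shows "(\<Sum>x\<in>X L. piece t t' n r x) = 0"
proof (cases "fail t n r")
  case True
  let ?h = "\<lambda>k x. if agree n x r \<and> good t' k x then 1 else 0 :: complex"
  have "piece t t' n r x = (\<Sum>k\<in>{n..<L}. ?h k x * (f (Suc k) x - f k x))" if x: "x \<in> X L" for x
  proof (cases "agree n x r")
    case xr: True
    have "fail t n x" using True fail_cong[OF X_G[OF x] assms(2) xr] by simp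
    then have bad: "bad t n x" and nb: "\<And>i. i < n \<Longrightarrow> \<not> bad t i x" by (auto simp: fail_def)
    then have low: "good t k x" "good t' k x" if "k < n" for k
      using that bad_mono[OF assms(1)] by (fastforce simp: good_def)+
    have high: "\<not> good t k x" if "n \<le> k" for k
      using that bad by (auto simp: good_def)
    \<comment> \<open>As \<open>n\<close> is positive, level 0 is not bad, so the initial values
      coincide.\<close>
    have f0: "cmod (f 0 x) \<le> t" using nb[of 0] assms(3) by (auto simp: bad_def)
    let ?d = "\<lambda>k. f (Suc k) x - f k x"
    have "stop t' L x - stop t L x = (\<Sum>k<L. (if good t' k x then ?d k else 0) - (if good t k x then ?d k else 0))"
      using f0 assms(1) by (simp add: stop_def sum_subtractf)
    also have "\<dots> = (\<Sum>k\<in>{n..<L}. ?h k x * ?d k)"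
      using low high xr by (intro sum.mono_neutral_cong_right) (auto simp: not_le)
    finally show ?thesis using xr True by (simp add: piece_def)
  qed (simp add: piece_def)
  then have "(\<Sum>x\<in>X L. piece t t' n r x) = (\<Sum>x\<in>X L. \<Sum>k\<in>{n..<L}. ?h k x * (f (Suc k) x - f k x))"
    by (intro sum.cong refl)
  also have "\<dots> = (\<Sum>k\<in>{n..<L}. \<Sum>x\<in>X L. ?h k x * (f (Suc k) x - f k x))"
    by (rule sum.swap)
  also have "\<dots> = 0"
  proof (rule sum.neutral, rule ballI, rule sum_mart_diff)
    fix k x y assume k: "k \<in> {n..<L}" and xy: "x \<in> X L" "y \<in> X L" "agree k x y"
    have "agree n x y" using k by (intro agree_le[OF xy(3)]) simp
    then have "agree n x r \<longleftrightarrow> agree n y r" by (metis agree_sym agree_trans)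
    then show "?h k x = ?h k y" using good_cong[OF X_G[OF xy(1)] X_G[OF xy(2)] xy(3)] by simp
  qed auto
  finally show ?thesis .
qed (simp add: piece_def)

section \<open>Stopping cylinders and level sets of the maximal function\<close>

definition ex_set :: "real \<Rightarrow> (nat \<Rightarrow> nat) set" where
  "ex_set t = {x \<in> X L. \<exists>i\<le>L. t < cmod (f i x)}"

lemma finite_ex_set: "finite (ex_set t)"
  by (simp add: ex_set_def)

text \<open>If \<open>f 0\<close> exceeds \<open>t\<close>, it does so on the whole cylinder.
  Otherwise \<open>f (Suc n)\<close> exceeds \<open>t\<close> on a subcylinder, whose share
  \<open>1 / m n\<close> is at least \<open>1 / B\<close>.\<close>

lemma fail_card:
  assumes "n < L" "r \<in> X n" "fail t n r"
  shows "M L / M n \<le> B * real (card {x \<in> ex_set t. agree n x r \<and> fail t n x})"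
proof -
  have rG: "r \<in> G" using assms(2) by (rule X_G)
  have fin: "finite {x \<in> ex_set t. agree n x r \<and> fail t n x}"
    using finite_ex_set by simp
  have fail: "fail t n x" if "x \<in> X L" "agree n x r" for x
    using fail_cong[OF X_G[OF that(1)] rG that(2)] assms(3) by simp
  show ?thesis
  proof (cases "t < cmod (f 0 r)")
    case True
    have "{x \<in> X L. agree n x r} \<subseteq> {x \<in> ex_set t. agree n x r \<and> fail t n x}"
      using fail True f0_eq[OF X_G rG] by (auto simp: ex_set_def)
    then have "real (card {x \<in> X L. agree n x r}) \<le> real (card {x \<in> ex_set t. agree n x r \<and> fail t n x})"
      unfolding of_nat_le_iff using fin by (rule card_mono[rotated])
    then have "1 * (M L / M n) \<le> B * real (card {x \<in> ex_set t. agree n x r \<and> fail t n x})"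
      using B_ge_1 card_agree[OF rG, of n L] assms(1) by (intro mult_mono) auto
    then show ?thesis by simp
  next
    case False
    then obtain y where y: "y \<in> X L" "agree n y r" "t < cmod (f (Suc n) y)"
      using assms(3) by (auto simp: fail_def bad_def)
    have "{x \<in> X L. agree (Suc n) x y} \<subseteq> {x \<in> ex_set t. agree n x r \<and> fail t n x}"
    proof
      fix x assume "x \<in> {x \<in> X L. agree (Suc n) x y}"
      then have x: "x \<in> X L" "agree (Suc n) x y" by auto
      have "f (Suc n) x = f (Suc n) y" using x y X_G by (intro f_cong) auto
      then have "x \<in> ex_set t" using x y(3) assms(1) by (auto simp: ex_set_def Suc_le_eq intro!: exI[of _ "Suc n"])
      moreover have "agree n x r" using agree_trans[OF agree_le[OF x(2)] y(2)] by simp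
      ultimately show "x \<in> {x \<in> ex_set t. agree n x r \<and> fail t n x}" using fail x(1) by simp
    qed
    then have "real (card {x \<in> X L. agree (Suc n) x y}) \<le> real (card {x \<in> ex_set t. agree n x r \<and> fail t n x})"
      unfolding of_nat_le_iff using fin by (rule card_mono[rotated])
    then have le: "M L / M (Suc n) \<le> real (card {x \<in> ex_set t. agree n x r \<and> fail t n x})"
      using card_agree[OF X_G[OF y(1)], of "Suc n" L] assms(1) by simp
    have "M L / M n = m n * (M L / M (Suc n))"
      using m_gr0[of n] by (simp add: vM_Suc)
    also have "\<dots> \<le> B * real (card {x \<in> ex_set t. agree n x r \<and> fail t n x})"
      using m_le[of n] le by (intro mult_mono) auto
    finally show ?thesis .
  qed
qed

text \<open>The stopping cylinders are disjoint: a point stops at one level at most and has one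
  representative there.\<close>

lemma sum_fail_card:
  "(\<Sum>n<L. \<Sum>r\<in>X n. real (card {x \<in> ex_set t. agree n x r \<and> fail t n x})) \<le> card (ex_set t)"
proof -
  have "(\<Sum>n<L. \<Sum>r\<in>X n. real (card {x \<in> ex_set t. agree n x r \<and> fail t n x})) =
      (\<Sum>n<L. \<Sum>r\<in>X n. \<Sum>x\<in>ex_set t. if agree n x r then (if fail t n x then 1 else 0) else 0)"
  proof (intro sum.cong refl)
    fix n r
    have "(\<Sum>x\<in>ex_set t. if agree n x r then (if fail t n x then 1 else 0) else 0) =
        (\<Sum>x\<in>ex_set t. if agree n x r \<and> fail t n x then 1 else 0 :: real)"
      by (intro sum.cong) auto
    then show "real (card {x \<in> ex_set t. agree n x r \<and> fail t n x}) =
        (\<Sum>x\<in>ex_set t. if agree n x r then (if fail t n x then 1 else 0) else 0)"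
      by (simp add: sum.inter_filter[OF finite_ex_set, symmetric])
  qed
  also have "\<dots> = (\<Sum>n<L. \<Sum>x\<in>ex_set t. \<Sum>r\<in>X n. if agree n x r then (if fail t n x then 1 else 0) else 0)"
    by (intro sum.cong refl sum.swap)
  also have "\<dots> = (\<Sum>n<L. \<Sum>x\<in>ex_set t. if fail t n x then 1 else 0)"
    by (intro sum.cong refl sum_X_agree X_G[of _ L]) (simp add: ex_set_def)
  also have "\<dots> = (\<Sum>x\<in>ex_set t. \<Sum>n<L. if fail t n x then 1 else 0)"
    by (rule sum.swap)
  also have "\<dots> \<le> (\<Sum>x\<in>ex_set t. 1)"
  proof (rule sum_mono)
    fix x
    have "card {n \<in> {..<L}. fail t n x} \<le> Suc 0"
      using fail_unique by (intro card_le_Suc0_iff_eq[THEN iffD2]) auto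
    then show "(\<Sum>n<L. if fail t n x then 1 else 0) \<le> (1::real)"
      by (simp add: sum.inter_filter[symmetric])
  qed
  finally show ?thesis by simp
qed

text \<open>Each piece is an atom of height \<open>t' + t\<close>, and the total size of the
  cylinders is controlled by the set where the maximal function exceeds \<open>t\<close>.\<close>

lemma Phi_stop_diff:
  assumes "0 < t" "t \<le> t'" "2 \<le> n" "n < M L"
  shows "Phi L n (\<lambda>x. stop t' L x - stop t L x) \<le>
    (6 + 63 * (real B)\<^sup>2) * ln n * (B * sqrt (t' + t)) * card (ex_set t)"
proof -
  define C where "C = (6 + 63 * (real B)\<^sup>2) * ln n * sqrt (t' + t)"
  have C: "0 \<le> C" using assms by (simp add: C_def)
  have p: "Phi L n (piece t t' i r) \<le> C * (B * real (card {x \<in> ex_set t. agree i x r \<and> fail t i x}))"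
    if i: "i < L" and r: "r \<in> X i" for i r
  proof (cases "fail t i r")
    case True
    interpret vilenkin_atom m B L i r "t' + t" "piece t t' i r"
    proof
      show "cmod (piece t t' i r x) \<le> t' + t" if "x \<in> X L" for x
        using stop_invariant[OF _ that, of t L] stop_invariant[OF _ that, of t' L] assms(1,2)
          norm_triangle_ineq4[of "stop t' L x" "stop t L x"]
        by (auto simp: piece_def)
      show "i = 0 \<or> (\<Sum>x\<in>X L. piece t t' i r x) = 0"
        using sum_piece_zero[OF assms(2) X_G[OF r]] by blast
    qed (use m_le i r X_G assms in \<open>auto simp: piece_def\<close>)
    have "Phi L n (piece t t' i r) \<le> C * (M L / M i)"
      using atom_estimate[OF assms(3,4)] by (simp add: Phi_def C_def mult_ac)
    also have "\<dots> \<le> C * (B * real (card {x \<in> ex_set t. agree i x r \<and> fail t i x}))"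
      using fail_card[OF i r True] C by (intro mult_left_mono)
    finally show ?thesis .
  next
    case False
    then have "piece t t' i r = (\<lambda>_. 0)" by (auto simp: piece_def)
    then show ?thesis using C by (simp add: Phi_zero)
  qed
  have "Phi L n (\<lambda>x. stop t' L x - stop t L x) = Phi L n (\<lambda>x. \<Sum>i<L. \<Sum>r\<in>X i. piece t t' i r x)"
    unfolding piece_def using assms by (intro Phi_cong stop_diff_sum) auto
  also have "\<dots> \<le> (\<Sum>i<L. Phi L n (\<lambda>x. \<Sum>r\<in>X i. piece t t' i r x))"
    by (rule Phi_sum_le) simp
  also have "\<dots> \<le> (\<Sum>i<L. \<Sum>r\<in>X i. Phi L n (piece t t' i r))"
    by (intro sum_mono Phi_sum_le finite_X)
  also have "\<dots> \<le> (\<Sum>i<L. \<Sum>r\<in>X i. C * (B * real (card {x \<in> ex_set t. agree i x r \<and> fail t i x})))"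
    using p by (intro sum_mono) auto
  also have "\<dots> = C * B * (\<Sum>i<L. \<Sum>r\<in>X i. real (card {x \<in> ex_set t. agree i x r \<and> fail t i x}))"
    by (simp add: sum_distrib_left mult_ac)
  also have "\<dots> \<le> C * B * card (ex_set t)"
    using C sum_fail_card by (intro mult_left_mono) auto
  finally show ?thesis by (simp add: C_def mult_ac)
qed

lemma Phi_stop_le:
  assumes "0 < t" "2 \<le> n" "n < M L"
  shows "Phi L n (stop t L) \<le> (6 + 63 * (real B)\<^sup>2) * ln n * (M L * sqrt t)"
proof -
  interpret vilenkin_atom m B L 0 "\<lambda>_. 0" t "stop t L"
    by unfold_locales (use m_le assms stop_invariant in \<open>auto simp: vgroup_iff\<close>)
  show ?thesis using atom_estimate[OF assms(2,3)] by (simp add: Phi_def vM_0)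
qed

text \<open>A layer-cake argument over dyadic heights: \<open>f L\<close> is the lowest stopped
  martingale plus a telescoping sum of layers. At \<open>x\<close> the roots of the exceeded heights
  sum to at most \<open>2 * sqrt (F x)\<close>.\<close>

lemma Phi_martingale_le:
  assumes n: "2 \<le> n" "n < M L" and F: "\<And>i x. i \<le> L \<Longrightarrow> x \<in> X L \<Longrightarrow> cmod (f i x) \<le> F x"
  shows "Phi L n (f L) \<le> (6 + 63 * (real B)\<^sup>2) * ln n * (6 * B * (\<Sum>x\<in>X L. sqrt (F x)))"
proof -
  define C where "C = (6 + 63 * (real B)\<^sup>2) * ln n"
  have C: "0 < C" using half_le_ln[OF n(1)] by (auto simp: C_def intro!: mult_pos_pos add_pos_nonneg)
  have F0: "0 \<le> F x" if "x \<in> X L" for x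
    using F[OF _ that, of 0] norm_ge_zero[of "f 0 x"] by linarith
  have main: "Phi L n (f L) \<le> C * (6 * B * (\<Sum>x\<in>X L. sqrt (F x))) + e" if e0: "0 < e" for e
  proof -
    \<comment> \<open>Chosen so that the bound for the lowest piece is exactly
      \<open>e\<close>.\<close>
    define e' where "e' = e / (C * M L)"
    have e: "0 < e'" using e0 C by (simp add: e'_def)
    define t where "t j = (e' * 2 ^ j)\<^sup>2" for j :: nat
    have t_pos: "0 < t j" for j using e by (simp add: t_def)
    have t_Suc: "t (Suc j) = 4 * t j" for j by (simp add: t_def power2_eq_square)
    have sqrt_t: "sqrt (t j) = e' * 2 ^ j" for j using e by (simp add: t_def)
    \<comment> \<open>The extra 1 makes \<open>e' * 2 ^ J\<close> at least 1, hence at most its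
      square \<open>t J\<close>.\<close>
    obtain J where J: "(1 + (\<Sum>x\<in>X L. F x)) / e' < 2 ^ J"
      using real_arch_pow[of 2] by auto
    have tJ: "F x \<le> t J" if x: "x \<in> X L" for x
    proof -
      have "F x \<le> (\<Sum>x\<in>X L. F x)" using F0 x by (intro member_le_sum) auto
      then have "1 + F x \<le> e' * 2 ^ J" using J e by (simp add: divide_less_eq mult.commute)
      then have "1 \<le> e' * 2 ^ J" "F x \<le> e' * 2 ^ J" using F0[OF x] by linarith+
      then show ?thesis unfolding t_def using self_le_power[of "e' * 2 ^ J" 2] by simp
    qed
    have top: "stop (t J) L x = f L x" if x: "x \<in> X L" for x
    proof -
      have le: "cmod (f i z) \<le> t J" if "i \<le> L" "z \<in> X L" for i z
        using F[OF that] tJ[OF that(2)] by linarith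
      then have "\<not> bad (t J) i x" if "i < L" for i
        using that x by (auto simp: bad_def not_less)
      then show ?thesis using stop_invariant[of "t J" x L] le x t_pos[of J] by auto
    qed
    have "Phi L n (f L) = Phi L n (\<lambda>x. stop (t 0) L x + (\<Sum>j<J. stop (t (Suc j)) L x - stop (t j) L x))"
      by (rule Phi_cong) (simp only: sum_lessThan_telescope[of "\<lambda>j. stop (t j) L _"] top add_diff_cancel_left' add_diff_eq)
    also have "\<dots> \<le> Phi L n (stop (t 0) L) + (\<Sum>j<J. Phi L n (\<lambda>x. stop (t (Suc j)) L x - stop (t j) L x))"
      by (intro order_trans[OF Phi_plus_le] add_left_mono Phi_sum_le) simp
    also have "\<dots> \<le> C * (M L * e') + (\<Sum>j<J. C * (3 * B * (e' * 2 ^ j * card (ex_set (t j)))))"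
    proof (intro add_mono sum_mono)
      show "Phi L n (stop (t 0) L) \<le> C * (M L * e')"
        using Phi_stop_le[OF t_pos[of 0] n] sqrt_t[of 0] by (simp add: C_def)
      fix j
      \<comment> \<open>The sum is \<open>5 * t j\<close>, rounded up to get a perfect square
        factor.\<close>
      have "sqrt (t (Suc j) + t j) \<le> sqrt (9 * t j)"
        using t_pos[of j] by (simp add: t_Suc)
      also have "\<dots> = 3 * (e' * 2 ^ j)" by (simp add: real_sqrt_mult sqrt_t)
      finally have sq: "sqrt (t (Suc j) + t j) \<le> 3 * (e' * 2 ^ j)" .
      have "Phi L n (\<lambda>x. stop (t (Suc j)) L x - stop (t j) L x) \<le> C * (B * sqrt (t (Suc j) + t j)) * card (ex_set (t j))"
        unfolding C_def using t_pos[of j] by (intro Phi_stop_diff n) (auto simp: t_Suc)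
      also have "\<dots> \<le> C * (B * (3 * (e' * 2 ^ j))) * card (ex_set (t j))"
        using C sq by (intro mult_left_mono mult_right_mono) auto
      finally show "Phi L n (\<lambda>x. stop (t (Suc j)) L x - stop (t j) L x) \<le> C * (3 * B * (e' * 2 ^ j * card (ex_set (t j))))"
        by (simp add: mult_ac)
    qed
    also have "\<dots> = C * (3 * B * (\<Sum>j<J. e' * 2 ^ j * card (ex_set (t j)))) + e"
      using C by (simp add: sum_distrib_left e'_def mult_ac)
    also have "\<dots> \<le> C * (3 * B * (\<Sum>x\<in>X L. 2 * sqrt (F x))) + e"
    proof -
      have "(\<Sum>j<J. e' * 2 ^ j * card (ex_set (t j))) = (\<Sum>j<J. \<Sum>x\<in>X L. if x \<in> ex_set (t j) then e' * 2 ^ j else 0)"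
      proof (intro sum.cong refl)
        fix j
        have "ex_set (t j) = {x \<in> X L. x \<in> ex_set (t j)}" by (auto simp: ex_set_def)
        then show "e' * 2 ^ j * card (ex_set (t j)) = (\<Sum>x\<in>X L. if x \<in> ex_set (t j) then e' * 2 ^ j else 0)"
          by (simp add: sum.inter_filter[symmetric])
      qed
      also have "\<dots> = (\<Sum>x\<in>X L. \<Sum>j<J. if x \<in> ex_set (t j) then e' * 2 ^ j else 0)"
        by (rule sum.swap)
      also have "\<dots> \<le> (\<Sum>x\<in>X L. 2 * sqrt (F x))"
      proof (rule sum_mono)
        fix x assume x: "x \<in> X L"
        have "e' * 2 ^ j < sqrt (F x)" if "x \<in> ex_set (t j)" for j
        proof -
          from that obtain i where "i \<le> L" "t j < cmod (f i x)" by (auto simp: ex_set_def)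
          then have "t j < F x" using F[of i x] x by simp
          then show ?thesis using sqrt_t[of j] by (metis real_sqrt_less_mono)
        qed
        then have "(\<Sum>j<J. if x \<in> ex_set (t j) then e' * 2 ^ j else 0) \<le> (\<Sum>j<J. if e' * 2 ^ j < sqrt (F x) then e' * 2 ^ j else 0)"
          using e by (intro sum_mono) auto
        also have "\<dots> \<le> 2 * sqrt (F x)"
          using e F0[OF x] by (intro sum_dyadic_below_le) auto
        finally show "(\<Sum>j<J. if x \<in> ex_set (t j) then e' * 2 ^ j else 0) \<le> 2 * sqrt (F x)" .
      qed
      finally show ?thesis using C by (intro add_right_mono mult_left_mono) auto
    qed
    also have "\<dots> = C * (6 * B * (\<Sum>x\<in>X L. sqrt (F x))) + e"
      by (simp add: sum_distrib_left[symmetric])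
    finally show ?thesis .
  qed
  show ?thesis
    unfolding C_def[symmetric] using main by (rule field_le_epsilon)
qed

end

section \<open>The Haar measure and quasi-norms\<close>

lemma epowr_half: "0 \<le> v \<Longrightarrow> epowr (ennreal v) (1 / 2) = ennreal (sqrt v)"
  by (simp add: epowr_def powr_half_sqrt)

lemma epowr_mono:
  assumes "a \<le> b" "0 \<le> p"
  shows "epowr a p \<le> epowr b p"
proof (cases "b = \<top>")
  case False
  then have "a \<noteq> \<top>" using assms(1) by (auto simp: top_unique)
  moreover have "enn2real a \<le> enn2real b"
    using assms(1) False by (simp add: enn2real_mono less_top)
  ultimately show ?thesis
    using False assms(2) by (auto simp: epowr_def intro!: ennreal_leI powr_mono2)
qed (simp add: epowr_def)

lemma epowr_Lp_norm_half: "epowr (Lp_norm \<mu> (1 / 2) g) (1 / 2) = (\<integral>\<^sup>+ x. epowr (g x) (1 / 2) \<partial>\<mu>)"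
proof -
  have "epowr (epowr a 2) (1 / 2) = a" for a
  proof (cases "a = \<top>")
    case False
    then have "(enn2real a powr 2) powr (1 / 2) = enn2real a" by (simp only: powr_powr) simp
    then show ?thesis using False by (simp add: epowr_def less_top)
  qed (simp add: epowr_def)
  then show ?thesis by (simp add: Lp_norm_def)
qed

section \<open>Integrals of functions of finite level\<close>

locale vilenkin_haar = vilenkin +
  fixes \<mu> :: "(nat \<Rightarrow> nat) measure"
  assumes haar: "haar_prob m \<mu>"
begin

lemma space_haar: "space \<mu> = G"
  using haar by (simp add: haar_prob_def)

lemma sets_vcyl: "r \<in> G \<Longrightarrow> vcyl m n r \<in> sets \<mu>"
  using haar openin_vcyl by (auto simp: haar_prob_def)

lemma emeasure_vcyl: "r \<in> G \<Longrightarrow> emeasure \<mu> (vcyl m n r) = ennreal (1 / M n)"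
  by (rule haar_prob_vcyl[OF m2 haar])

lemma measure_vcyl: "r \<in> G \<Longrightarrow> measure \<mu> (vcyl m n r) = 1 / M n"
  by (simp add: measure_def emeasure_vcyl)

lemma vcyl_agree: "x \<in> G \<Longrightarrow> x \<in> vcyl m n r \<longleftrightarrow> agree n x r"
  by (simp add: vcyl_def agree_def)

lemma integral_level:
  fixes h :: "(nat \<Rightarrow> nat) \<Rightarrow> complex"
  assumes "\<And>x y. x \<in> G \<Longrightarrow> y \<in> G \<Longrightarrow> agree L x y \<Longrightarrow> h x = h y"
  shows "integral\<^sup>L \<mu> h = (\<Sum>x\<in>X L. h x) / of_nat (M L)"
proof -
  have "has_bochner_integral \<mu> (\<lambda>x. \<Sum>r\<in>X L. indicator (vcyl m L r) x *\<^sub>R h r)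
      (\<Sum>r\<in>X L. measure \<mu> (vcyl m L r) *\<^sub>R h r)"
    using sets_vcyl[OF X_G] emeasure_vcyl[OF X_G]
    by (intro has_bochner_integral_sum has_bochner_integral_indicator) auto
  then have "(\<integral>x. (\<Sum>r\<in>X L. indicator (vcyl m L r) x *\<^sub>R h r) \<partial>\<mu>) = (\<Sum>r\<in>X L. measure \<mu> (vcyl m L r) *\<^sub>R h r)"
    by (rule has_bochner_integral_integral_eq)
  also have "(\<integral>x. (\<Sum>r\<in>X L. indicator (vcyl m L r) x *\<^sub>R h r) \<partial>\<mu>) = integral\<^sup>L \<mu> h"
  proof (rule Bochner_Integration.integral_cong[OF refl])
    fix x assume "x \<in> space \<mu>"
    then have x: "x \<in> G" by (simp add: space_haar)
    have "(\<Sum>r\<in>X L. indicator (vcyl m L r) x *\<^sub>R h r) = (\<Sum>r\<in>X L. if agree L x r then h x else 0)"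
      using assms[OF x X_G] by (intro sum.cong) (auto simp: indicator_def vcyl_agree[OF x])
    then show "(\<Sum>r\<in>X L. indicator (vcyl m L r) x *\<^sub>R h r) = h x"
      by (simp only: sum_X_agree[OF x])
  qed
  also have "(\<Sum>r\<in>X L. measure \<mu> (vcyl m L r) *\<^sub>R h r) = (\<Sum>x\<in>X L. h x) / of_nat (M L)"
    unfolding sum_divide_distrib by (intro sum.cong refl) (simp add: measure_vcyl[OF X_G] scaleR_conv_of_real)
  finally show ?thesis .
qed

lemma nn_integral_level:
  fixes h :: "(nat \<Rightarrow> nat) \<Rightarrow> real"
  assumes "\<And>x y. x \<in> G \<Longrightarrow> y \<in> G \<Longrightarrow> agree L x y \<Longrightarrow> h x = h y" "\<And>x. x \<in> G \<Longrightarrow> 0 \<le> h x"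
  shows "(\<integral>\<^sup>+ x. ennreal (h x) \<partial>\<mu>) = ennreal ((\<Sum>x\<in>X L. h x) / M L)"
proof -
  have "(\<integral>\<^sup>+ x. ennreal (h x) \<partial>\<mu>) = (\<integral>\<^sup>+ x. (\<Sum>r\<in>X L. ennreal (h r) * indicator (vcyl m L r) x) \<partial>\<mu>)"
  proof (rule nn_integral_cong)
    fix x assume "x \<in> space \<mu>"
    then have x: "x \<in> G" by (simp add: space_haar)
    have "h x = (\<Sum>r\<in>X L. if agree L x r then h x else 0)"
      by (rule sum_X_agree[OF x, symmetric])
    then have "ennreal (h x) = (\<Sum>r\<in>X L. ennreal (if agree L x r then h x else 0))"
      using assms(2)[OF x] by (simp add: sum_ennreal)
    also have "\<dots> = (\<Sum>r\<in>X L. ennreal (h r) * indicator (vcyl m L r) x)"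
      using assms(1)[OF x X_G] by (intro sum.cong) (auto simp: indicator_def vcyl_agree[OF x])
    finally show "ennreal (h x) = (\<Sum>r\<in>X L. ennreal (h r) * indicator (vcyl m L r) x)" .
  qed
  also have "\<dots> = (\<Sum>r\<in>X L. ennreal (h r) * ennreal (1 / M L))"
    using sets_vcyl[OF X_G] emeasure_vcyl[OF X_G]
    by (subst nn_integral_sum) (auto simp: nn_integral_cmult_indicator intro!: sum.cong)
  also have "\<dots> = ennreal ((\<Sum>x\<in>X L. h x) / M L)"
    using assms(2)[OF X_G]
    by (simp add: ennreal_mult[symmetric] sum_ennreal sum_divide_distrib del: ennreal_mult')
  finally show ?thesis .
qed

lemma fun_coeff_level:
  assumes "\<And>x y. x \<in> G \<Longrightarrow> y \<in> G \<Longrightarrow> agree L x y \<Longrightarrow> g x = g y" "i < M L"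
  shows "fun_coeff m \<mu> g i = fc L g i"
proof -
  have "g x * cnj (\<psi> i x) = g y * cnj (\<psi> i y)" if "x \<in> G" "y \<in> G" "agree L x y" for x y
    using assms(1)[OF that] psi_cong[OF assms(2) that(3)] by simp
  then show ?thesis unfolding fun_coeff_def fc_def by (rule integral_level)
qed

section \<open>Coefficients and averages of a martingale\<close>

context
  fixes f :: "nat \<Rightarrow> (nat \<Rightarrow> nat) \<Rightarrow> complex"
  assumes mart: "vmartingale m \<mu> f"
begin

lemma mart_eq: "n \<le> k \<Longrightarrow> x \<in> G \<Longrightarrow> f n x = (\<Sum>i<M n. fun_coeff m \<mu> (f k) i * \<psi> i x)"
  using mart by (simp add: vmartingale_def fun_partial_sum_def)

text \<open>The martingale identity with equal levels writes \<open>f n\<close> through characters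
  of index below \<open>M n\<close>, which see only the first \<open>n\<close> digits.\<close>

lemma mart_cong:
  assumes "x \<in> G" "y \<in> G" "agree k x y" "n \<le> k"
  shows "f n x = f n y"
proof -
  have "\<psi> i x = \<psi> i y" if "i < M n" for i
    using that agree_le[OF assms(3,4)] by (rule psi_cong)
  then show ?thesis using mart_eq[of n n x] mart_eq[of n n y] assms by simp
qed

text \<open>\<open>f n\<close> is a partial sum of the expansion of \<open>f k\<close>, so
  orthogonality recovers the coefficient.\<close>

lemma mart_coeff_stable:
  assumes "n \<le> k" "i < M n"
  shows "fun_coeff m \<mu> (f k) i = fun_coeff m \<mu> (f n) i"
proof -
  have iM: "i < M k" using assms M_mono by (meson less_le_trans)
  let ?c = "fun_coeff m \<mu> (f k)"
  have z: "(\<lambda>_. 0) \<in> G" by (simp add: vgroup_iff)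
  have "fun_coeff m \<mu> (f n) i = fc k (f n) i"
    using assms(1) by (intro fun_coeff_level iM mart_cong)
  also have "\<dots> = (\<Sum>x\<in>X k. \<Sum>j<M n. ?c j * (\<psi> j x * cnj (\<psi> i x))) / of_nat (M k)"
    unfolding fc_def
    by (intro arg_cong2[of _ _ _ _ "(/)"] sum.cong refl) (simp add: mart_eq[OF assms(1) X_G] sum_distrib_right mult.assoc)
  also have "(\<Sum>x\<in>X k. \<Sum>j<M n. ?c j * (\<psi> j x * cnj (\<psi> i x))) = (\<Sum>j<M n. ?c j * (\<Sum>x | x \<in> X k \<and> agree 0 x (\<lambda>_. 0). \<psi> j x * cnj (\<psi> i x)))"
    by (subst sum.swap) (simp add: sum_distrib_left)
  also have "\<dots> = (\<Sum>j<M n. if j = i then ?c i * of_nat (M k) else 0)"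
  proof (intro sum.cong refl)
    fix j assume "j \<in> {..<M n}"
    then have "j < M k" using M_mono[OF assms(1)] by simp
    then have "(\<Sum>x | x \<in> X k \<and> agree 0 x (\<lambda>_. 0). \<psi> j x * cnj (\<psi> i x)) = (if j = i then of_nat (M k) / of_nat (M 0) else 0)"
      using iM by (intro sum_psi_orthogonal z) (simp_all add: vM_0)
    then show "?c j * (\<Sum>x | x \<in> X k \<and> agree 0 x (\<lambda>_. 0). \<psi> j x * cnj (\<psi> i x)) = (if j = i then ?c i * of_nat (M k) else 0)"
      by (simp add: vM_0)
  qed
  also have "\<dots> = ?c i * of_nat (M k)" using assms(2) by simp
  finally show ?thesis by simp
qed

text \<open>The coefficients are constant from level \<open>L\<close> on, so the limit is
  attained.\<close>

lemma mart_coeff_eq: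
  assumes "i < M L"
  shows "mart_coeff m \<mu> f i = fc L (f L) i"
proof -
  have "fun_coeff m \<mu> (f k) i = fc L (f L) i" if "L \<le> k" for k
    using mart_coeff_stable[OF that assms] fun_coeff_level[OF mart_cong[of _ _ L L] assms] by simp
  then have "(\<lambda>k. fun_coeff m \<mu> (f k) i) \<longlonglongrightarrow> fc L (f L) i"
    by (intro tendsto_eventually eventually_sequentiallyI[of L])
  then show ?thesis unfolding mart_coeff_def by (rule limI)
qed

lemma fejer_mean_eq:
  assumes "k \<le> M L"
  shows "fejer_mean m \<mu> f k x = fej L (f L) k x"
proof -
  have "mart_partial_sum m \<mu> f j x = psum L (f L) 0 j x" if "j \<le> M L" for j
    unfolding mart_partial_sum_def psum_def using that
    by (intro sum.cong refl) (simp add: vM_0 mart_coeff_eq[of _ L])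
  then show ?thesis
    using assms by (simp add: fejer_mean_def fej_def)
qed

text \<open>Conditional expectation: by \<open>dir_M\<close> the kernel of order \<open>M n\<close>
  averages over the cylinder.\<close>

lemma mart_avg:
  assumes "n < L" "y \<in> G"
  shows "(\<Sum>x | x \<in> X L \<and> agree n x y. f (Suc n) x) = of_nat (M L) / of_nat (M n) * f n y"
proof -
  have "f n y = (\<Sum>i<M n. fc L (f (Suc n)) i * \<psi> i y)"
  proof -
    have "fun_coeff m \<mu> (f (Suc n)) i = fc L (f (Suc n)) i" if "i < M n" for i
      using that assms(1) M_mono[of n L] by (intro fun_coeff_level mart_cong[where k = L]) auto
    then show ?thesis using mart_eq[of n "Suc n" y] assms(2) by simp
  qed
  also have "\<dots> = (\<Sum>i<M n. \<Sum>x\<in>X L. f (Suc n) x * (\<psi> i y * cnj (\<psi> i x)) / of_nat (M L))"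
    unfolding fc_def sum_divide_distrib sum_distrib_right by (intro sum.cong refl) (simp add: mult_ac)
  also have "\<dots> = (\<Sum>x\<in>X L. f (Suc n) x * dir 0 (M n) y x / of_nat (M L))"
    by (subst sum.swap) (simp add: dir_def vM_0 sum_distrib_left sum_divide_distrib)
  also have "\<dots> = (\<Sum>x\<in>X L. if agree n x y then of_nat (M n) / of_nat (M L) * f (Suc n) x else 0)"
  proof (intro sum.cong refl)
    fix x assume x: "x \<in> X L"
    have "agree n x y \<longleftrightarrow> agree n y x" by (metis agree_sym)
    then show "f (Suc n) x * dir 0 (M n) y x / of_nat (M L) = (if agree n x y then of_nat (M n) / of_nat (M L) * f (Suc n) x else 0)"
      by (simp add: dir_M[OF assms(2) X_G[OF x]])
  qed
  also have "\<dots> = of_nat (M n) / of_nat (M L) * (\<Sum>x | x \<in> X L \<and> agree n x y. f (Suc n) x)"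
    by (simp only: sum.inter_filter[OF finite_X, symmetric] sum_distrib_left)
  finally show ?thesis by simp
qed

lemma fejer_log_mean_le:
  assumes B: "\<And>k. m k \<le> B" and n: "2 \<le> n"
  shows "ennreal (1 / ln (real n)) *
      (\<Sum>k=1..n. epowr (Lp_norm \<mu> (1/2) (\<lambda>x. ennreal (cmod (fejer_mean m \<mu> f k x)))) (1/2) / of_nat k)
      \<le> ennreal (6 * B * (6 + 63 * (real B)\<^sup>2)) * epowr (hardy_norm \<mu> (1/2) f) (1/2)"
proof -
  \<comment> \<open>As \<open>n < M n\<close>, level \<open>n\<close> determines all means of order
    at most \<open>n\<close>.\<close>
  define L where "L = n"
  have L: "n < M L" "0 < L" using vM_ge[OF m2, of n] n by (simp_all add: L_def)
  interpret vilenkin_martingale m B L f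
    by unfold_locales (use B L mart_cong mart_avg in auto)
  \<comment> \<open>Unlike the full supremum, a finite maximum is finite and constant on cylinders
    of level \<open>L\<close>, so the integral of its root is an average over
    \<open>X L\<close>.\<close>
  define F where "F x = Max ((\<lambda>i. cmod (f i x)) ` {..L})" for x
  have F: "cmod (f i x) \<le> F x" if "i \<le> L" for i x
    unfolding F_def using that by (intro Max_ge) auto
  have F0: "0 \<le> F x" for x using F[of 0 x] norm_ge_zero[of "f 0 x"] by linarith
  have F_cong: "F x = F y" if "x \<in> G" "y \<in> G" "agree L x y" for x y
    unfolding F_def using mart_cong[OF that] by (intro arg_cong[of _ _ Max] image_cong) auto
  have ln: "0 < ln (real n)" using half_le_ln[OF n] by simp
  define S where "S k = (\<Sum>x\<in>X L. sqrt (cmod (fej L (f L) k x)))" for k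
  have S0: "0 \<le> S k" for k by (simp add: S_def sum_nonneg)
  have summand: "epowr (Lp_norm \<mu> (1/2) (\<lambda>x. ennreal (cmod (fejer_mean m \<mu> f k x)))) (1/2) = ennreal (S k / M L)"
    if "k \<le> n" for k
  proof -
    have fej: "fej L (f L) k x = fej L (f L) k y" if "x \<in> G" "y \<in> G" "agree L x y" for x y
    proof -
      have "\<psi> i x = \<psi> i y" if "i < k" for i
        using that \<open>k \<le> n\<close> L(1) \<open>agree L x y\<close> by (intro psi_cong[of i L]) auto
      then have "psum L (f L) 0 j x = psum L (f L) 0 j y" if "j \<le> k" for j
        unfolding psum_def using that by (intro sum.cong) auto
      then show ?thesis unfolding fej_def by simp
    qed
    have "(\<integral>\<^sup>+ x. ennreal (sqrt (cmod (fej L (f L) k x))) \<partial>\<mu>) = ennreal (S k / M L)"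
      unfolding S_def
      by (rule nn_integral_level) (simp_all only: fej real_sqrt_ge_zero norm_ge_zero)
    then show ?thesis
      using that L(1) by (simp add: epowr_Lp_norm_half epowr_half[simplified] fejer_mean_eq[of _ L])
  qed
  have "ennreal (1 / ln (real n)) *
      (\<Sum>k=1..n. epowr (Lp_norm \<mu> (1/2) (\<lambda>x. ennreal (cmod (fejer_mean m \<mu> f k x)))) (1/2) / of_nat k) =
      ennreal (1 / ln (real n)) * (\<Sum>k=1..n. ennreal (S k / M L / k))"
  proof (intro arg_cong2[of _ _ _ _ "(*)"] sum.cong refl)
    fix k assume "k \<in> {1..n}"
    then show "epowr (Lp_norm \<mu> (1/2) (\<lambda>x. ennreal (cmod (fejer_mean m \<mu> f k x)))) (1/2) / of_nat k = ennreal (S k / M L / k)"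
      using S0[of k] by (subst summand) (auto simp: ennreal_of_nat_eq_real_of_nat divide_ennreal)
  qed
  also have "\<dots> = ennreal (1 / ln (real n) * (\<Sum>k=1..n. S k / M L / k))"
  proof -
    have nonneg: "0 \<le> S k / M L / k" for k using S0[of k] by simp
    then have "(\<Sum>k=1..n. ennreal (S k / M L / k)) = ennreal (\<Sum>k=1..n. S k / M L / k)"
      by (intro sum_ennreal)
    moreover have "0 \<le> (\<Sum>k=1..n. S k / M L / k)" using nonneg by (rule sum_nonneg)
    ultimately show ?thesis using ln by (simp only: ennreal_mult divide_nonneg_pos zero_le_one)
  qed
  also have "(\<Sum>k=1..n. S k / M L / k) = Phi L n (f L) / M L"
    unfolding Phi_def S_def[symmetric] sum_divide_distrib by (intro sum.cong) auto
  also have "ennreal (1 / ln (real n) * (Phi L n (f L) / M L)) \<le>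
      ennreal (6 * B * (6 + 63 * (real B)\<^sup>2) * ((\<Sum>x\<in>X L. sqrt (F x)) / M L))"
  proof (rule ennreal_leI)
    have "Phi L n (f L) \<le> (6 + 63 * (real B)\<^sup>2) * ln n * (6 * B * (\<Sum>x\<in>X L. sqrt (F x)))"
      using n L F by (intro Phi_martingale_le) auto
    then have "Phi L n (f L) / (ln n * M L) \<le> (6 + 63 * (real B)\<^sup>2) * ln n * (6 * B * (\<Sum>x\<in>X L. sqrt (F x))) / (ln n * M L)"
      using ln by (intro divide_right_mono) auto
    also have "\<dots> = 6 * B * (6 + 63 * (real B)\<^sup>2) * ((\<Sum>x\<in>X L. sqrt (F x)) / M L)"
      using ln by (simp add: mult_ac)
    finally show "1 / ln (real n) * (Phi L n (f L) / M L) \<le> 6 * B * (6 + 63 * (real B)\<^sup>2) * ((\<Sum>x\<in>X L. sqrt (F x)) / M L)"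
      by simp
  qed
  also have "\<dots> = ennreal (6 * B * (6 + 63 * (real B)\<^sup>2)) * ennreal ((\<Sum>x\<in>X L. sqrt (F x)) / M L)"
    using F0 by (intro ennreal_mult divide_nonneg_nonneg sum_nonneg) auto
  also have "ennreal ((\<Sum>x\<in>X L. sqrt (F x)) / M L) = (\<integral>\<^sup>+ x. ennreal (sqrt (F x)) \<partial>\<mu>)"
    by (rule nn_integral_level[OF arg_cong[OF F_cong], symmetric]) (simp_all only: F0 real_sqrt_ge_zero)
  also have "\<dots> \<le> epowr (hardy_norm \<mu> (1/2) f) (1/2)"
    unfolding hardy_norm_def epowr_Lp_norm_half
  proof (rule nn_integral_mono)
    fix x
    have "F x \<in> (\<lambda>i. cmod (f i x)) ` {..L}" unfolding F_def by (intro Max_in) auto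
    then obtain i where "F x = cmod (f i x)" by blast
    then have "ennreal (F x) \<le> mart_max f x" unfolding mart_max_def by (auto intro: SUP_upper)
    then have "epowr (ennreal (F x)) (1 / 2) \<le> epowr (mart_max f x) (1 / 2)" by (rule epowr_mono) simp
    then show "ennreal (sqrt (F x)) \<le> epowr (mart_max f x) (1 / 2)"
      by (simp only: epowr_half[OF F0])
  qed
  finally show ?thesis by (simp add: mult_left_mono)
qed

end

end

theorem theorem3p28:
  fixes m :: "nat \<Rightarrow> nat" and \<mu> :: "(nat \<Rightarrow> nat) measure"
  assumes "\<forall>k. 2 \<le> m k"
    and "bdd_above (range m)"
    and "haar_prob m \<mu>"
  shows "\<exists>c::real. 0 < c \<and>
    (\<forall>f \<in> hardy_space m \<mu> (1/2). \<forall>n::nat. 2 \<le> n \<longrightarrow>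
      ennreal (1 / ln (real n)) *
        (\<Sum>k=1..n. epowr (Lp_norm \<mu> (1/2) (\<lambda>x. ennreal (cmod (fejer_mean m \<mu> f k x)))) (1/2) / of_nat k)
      \<le> ennreal c * epowr (hardy_norm \<mu> (1/2) f) (1/2))"
proof -
  interpret vilenkin_haar m \<mu>
    using assms(1,3) by unfold_locales
  obtain B where B: "m k \<le> B" for k
    using assms(2) by (auto simp: bdd_above_def)
  have "0 < B" using B[of 0] assms(1) by (metis less_le_trans pos2)
  then have "0 < 6 * real B * (6 + 63 * (real B)\<^sup>2)"
    by (intro mult_pos_pos add_pos_nonneg) auto
  \<comment> \<open>The constant depends only on the bound \<open>B\<close> of \<open>m\<close>, so
    it serves all \<open>f\<close> and \<open>n\<close>.\<close>
  then show ?thesis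
    using fejer_log_mean_le B by (intro exI[of _ "6 * real B * (6 + 63 * (real B)\<^sup>2)"]) (auto simp: hardy_space_def)
qed

end
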